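(* Let $S^2$ be a connected, non-compact surface properly immersed in $\mathbb R^3$, let $o\in\mathbb R^3$, $r=\operatorname{dist}_{\mathbb R^3}(o,\cdot)$, and fix $\rho>0$. Suppose that the $o$-radial mean convexity of $S$ is nonnegative: $\mathcal C(x)\ge 0$ for all $x\in S$. If $S$ is hyperbolic, then (i) either there does not exist a smooth positive function $g$ such that $\|\nabla^S r(x)\|\ge g(r(x))>0$ for all $x\in S$; (ii) or, in case $S$ satisfies such a radial tangency condition at $o$ with smooth positive function $g$, then $$\int_\rho^\infty r\,\exp\Bigl(-\int_\rho^r\frac{2}{t\,g^2(t)}\,dt\Bigr)\,dr<\infty .$$ (That is, the integral is finite for every smooth positive $g$ with $\|\nabla^S r(x)\|\ge g(r(x))$ for all $x\in S$.)
   Context: The same letter $r$ denotes the restriction of $r$ to $S$; $\nabla^{\mathbb R^3} r$ and $\nabla^S r$ are the gradients of $r$ in $\mathbb R^3$ and in $S$, and $\nabla^S r$ is the component of $\nabla^{\mathbb R^3} r$ tangent to $S$. Conditions involving these gradients are imposed at points of $S$ with $r(x)>0$. The function $g:[0,\infty)\to(0,\infty)$ is smooth. $H_S$ is the mean curvature vector of $S$ in $\mathbb R^3$ (half the trace of the second fundamental form), and the $o$-radial mean convexity of $S$ is $\mathcal C(x)=-\langle\nabla^{\mathbb R^3} r(x),H_S(x)\rangle$. A connected non-compact Riemannian manifold $S$ is parabolic if every subharmonic function on $S$ that is bounded above is constant (equivalently, some non-empty precompact open subset has zero capacity in $S$), and hyperbolic otherwise. *)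

theory Defs
  imports "HOL-Analysis.Analysis"
begin

text \<open>\<open>Ck_on k f S\<close> is meant for open \<open>S\<close>, where \<open>at x\<close> and \<open>at x within S\<close> agree.
  Continuity of all directional derivatives up to order \<open>k\<close> is enforced by the base case.\<close>

primrec Ck_on :: "nat \<Rightarrow> ('a::euclidean_space \<Rightarrow> 'b::real_normed_vector) \<Rightarrow> 'a set \<Rightarrow> bool" where
  "Ck_on 0 f S \<longleftrightarrow> continuous_on S f"
| "Ck_on (Suc k) f S \<longleftrightarrow> (\<forall>x\<in>S. f differentiable (at x)) \<and>
     (\<forall>v. Ck_on k (\<lambda>x. frechet_derivative f (at x) v) S)"

definition smooth_on :: "('a::euclidean_space \<Rightarrow> 'b::real_normed_vector) \<Rightarrow> 'a set \<Rightarrow> bool" where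
  "smooth_on f S \<longleftrightarrow> (\<forall>k. Ck_on k f S)"

text \<open>A smooth function \<open>[0,\<infinity>) \<rightarrow> (0,\<infinity>)\<close>; smoothness at the endpoint \<open>0\<close> means existence of
  a smooth extension. Values of \<open>g\<close> at negative arguments are irrelevant.\<close>

definition smooth_positive_halfline :: "(real \<Rightarrow> real) \<Rightarrow> bool" where
  "smooth_positive_halfline g \<longleftrightarrow>
     (\<forall>t\<ge>0. g t > 0) \<and> (\<exists>h. smooth_on h (UNIV :: real set) \<and> (\<forall>t\<ge>0. g t = h t))"

type_synonym 'a chart = "'a set \<times> ('a \<Rightarrow> real^2)"

text \<open>The expression of \<open>u\<close> in the chart \<open>c = (U, \<phi>)\<close>, namely \<open>u \<circ> \<phi>\<inverse>\<close> on \<open>\<phi>(U)\<close>.\<close>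

definition local_rep :: "('a \<Rightarrow> 'b) \<Rightarrow> 'a chart \<Rightarrow> real^2 \<Rightarrow> 'b" where
  "local_rep u c = u \<circ> inv_into (fst c) (snd c)"

definition surface_chart :: "'a topology \<Rightarrow> 'a chart \<Rightarrow> bool" where
  "surface_chart M c \<longleftrightarrow> (case c of (U, \<phi>) \<Rightarrow>
     openin M U \<and> open (\<phi> ` U) \<and>
     homeomorphic_map (subtopology M U) (top_of_set (\<phi> ` U)) \<phi>)"

text \<open>\<open>A\<close> is a smooth atlas, not required to be maximal, on the topological surface \<open>M\<close>.\<close>

definition smooth_surface :: "'a topology \<Rightarrow> 'a chart set \<Rightarrow> bool" where
  "smooth_surface M A \<longleftrightarrow>
     Hausdorff_space M \<and> second_countable M \<and>
     (\<forall>c\<in>A. surface_chart M c) \<and>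
     (\<Union>c\<in>A. fst c) = topspace M \<and>
     (\<forall>c\<in>A. \<forall>d\<in>A. smooth_on (local_rep (snd d) c) (snd c ` (fst c \<inter> fst d)))"

definition Ck_on_surface :: "'a chart set \<Rightarrow> nat \<Rightarrow> ('a \<Rightarrow> real) \<Rightarrow> bool" where
  "Ck_on_surface A k u \<longleftrightarrow> (\<forall>c\<in>A. Ck_on k (local_rep u c) (snd c ` fst c))"

definition smooth_immersion :: "'a chart set \<Rightarrow> ('a \<Rightarrow> real^3) \<Rightarrow> bool" where
  "smooth_immersion A f \<longleftrightarrow> (\<forall>c\<in>A.
     smooth_on (local_rep f c) (snd c ` fst c) \<and>
     (\<forall>y\<in>snd c ` fst c. inj (frechet_derivative (local_rep f c) (at y))))"

definition partial :: "(real^2 \<Rightarrow> 'b::real_normed_vector) \<Rightarrow> 2 \<Rightarrow> real^2 \<Rightarrow> 'b" where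
  "partial F i y = frechet_derivative F (at y) (axis i 1)"

definition first_form :: "(real^2 \<Rightarrow> real^3) \<Rightarrow> real^2 \<Rightarrow> real^2^2" where
  "first_form F y = (\<chi> i j. partial F i y \<bullet> partial F j y)"

text \<open>Orthogonal projection of \<open>w\<close> to the tangent plane spanned by the \<open>\<partial>\<^sub>iF(y)\<close>:
  \<open>g\<^sup>i\<^sup>j \<langle>w, \<partial>\<^sub>iF\<rangle> \<partial>\<^sub>jF\<close>.\<close>

definition tangential_part :: "(real^2 \<Rightarrow> real^3) \<Rightarrow> real^2 \<Rightarrow> real^3 \<Rightarrow> real^3" where
  "tangential_part F y w =
     (\<Sum>i\<in>UNIV. \<Sum>j\<in>UNIV. (matrix_inv (first_form F y) $ i $ j * (w \<bullet> partial F i y)) *\<^sub>R partial F j y)"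

text \<open>The second fundamental form on coordinate vectors is the normal part of \<open>\<partial>\<^sub>i\<partial>\<^sub>jF\<close>.\<close>

definition second_form :: "(real^2 \<Rightarrow> real^3) \<Rightarrow> real^2 \<Rightarrow> 2 \<Rightarrow> 2 \<Rightarrow> real^3" where
  "second_form F y i j =
     partial (partial F j) i y - tangential_part F y (partial (partial F j) i y)"

definition mean_curvature_vector :: "(real^2 \<Rightarrow> real^3) \<Rightarrow> real^2 \<Rightarrow> real^3" where
  "mean_curvature_vector F y =
     (1/2) *\<^sub>R (\<Sum>i\<in>UNIV. \<Sum>j\<in>UNIV. matrix_inv (first_form F y) $ i $ j *\<^sub>R second_form F y i j)"

text \<open>The gradient, for the metric induced by \<open>F\<close>, of a function \<open>u\<close> of the parameters,
  viewed as a vector of \<open>\<real>\<^sup>3\<close> via the differential of \<open>F\<close>: \<open>g\<^sup>i\<^sup>j \<partial>\<^sub>iu \<partial>\<^sub>jF\<close>.\<close>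

definition surface_gradient :: "(real^2 \<Rightarrow> real^3) \<Rightarrow> (real^2 \<Rightarrow> real) \<Rightarrow> real^2 \<Rightarrow> real^3" where
  "surface_gradient F u y =
     (\<Sum>i\<in>UNIV. \<Sum>j\<in>UNIV. (matrix_inv (first_form F y) $ i $ j * partial u i y) *\<^sub>R partial F j y)"

text \<open>Laplace-Beltrami operator of the metric \<open>G\<close>:
  \<open>(det G)\<^sup>-\<^sup>1\<^sup>/\<^sup>2 \<partial>\<^sub>i ((det G)\<^sup>1\<^sup>/\<^sup>2 g\<^sup>i\<^sup>j \<partial>\<^sub>ju)\<close>.\<close>

definition laplace_beltrami :: "(real^2 \<Rightarrow> real^2^2) \<Rightarrow> (real^2 \<Rightarrow> real) \<Rightarrow> real^2 \<Rightarrow> real" where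
  "laplace_beltrami G u y =
     (1 / sqrt (det (G y))) *
     (\<Sum>i\<in>UNIV. partial (\<lambda>z. sqrt (det (G z)) *
        (\<Sum>j\<in>UNIV. matrix_inv (G z) $ i $ j * partial u j z)) i y)"

text \<open>Classical (twice continuously differentiable) subharmonic functions for the metric
  induced by \<open>f\<close>.\<close>

definition subharmonic_on_surface :: "'a chart set \<Rightarrow> ('a \<Rightarrow> real^3) \<Rightarrow> ('a \<Rightarrow> real) \<Rightarrow> bool" where
  "subharmonic_on_surface A f u \<longleftrightarrow> Ck_on_surface A 2 u \<and>
     (\<forall>c\<in>A. \<forall>y\<in>snd c ` fst c.
        laplace_beltrami (first_form (local_rep f c)) (local_rep u c) y \<ge> 0)"

definition parabolic :: "'a topology \<Rightarrow> 'a chart set \<Rightarrow> ('a \<Rightarrow> real^3) \<Rightarrow> bool" where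
  "parabolic M A f \<longleftrightarrow> (\<forall>u. subharmonic_on_surface A f u \<and> bdd_above (u ` topspace M) \<longrightarrow>
     u constant_on topspace M)"

definition hyperbolic :: "'a topology \<Rightarrow> 'a chart set \<Rightarrow> ('a \<Rightarrow> real^3) \<Rightarrow> bool" where
  "hyperbolic M A f \<longleftrightarrow> \<not> parabolic M A f"

definition ambient_gradient :: "(real^3 \<Rightarrow> real) \<Rightarrow> real^3 \<Rightarrow> real^3" where
  "ambient_gradient h z = (THE D. GDERIV h z :> D)"

text \<open>The radial mean convexity at the point \<open>x\<close> of the surface, computed in a chart \<open>c\<close> at \<open>x\<close>
  (the value does not depend on the choice of \<open>c\<close>). It is meaningful only where \<open>f x \<noteq> p\<close>.\<close>

definition radial_mean_convexity :: "('a \<Rightarrow> real^3) \<Rightarrow> real^3 \<Rightarrow> 'a chart \<Rightarrow> 'a \<Rightarrow> real" where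
  "radial_mean_convexity f p c x =
     - (ambient_gradient (dist p) (f x) \<bullet> mean_curvature_vector (local_rep f c) (snd c x))"

definition radially_mean_convex :: "'a chart set \<Rightarrow> ('a \<Rightarrow> real^3) \<Rightarrow> real^3 \<Rightarrow> bool" where
  "radially_mean_convex A f p \<longleftrightarrow>
     (\<forall>c\<in>A. \<forall>x\<in>fst c. dist p (f x) > 0 \<longrightarrow> radial_mean_convexity f p c x \<ge> 0)"

definition radial_tangency :: "'a chart set \<Rightarrow> ('a \<Rightarrow> real^3) \<Rightarrow> real^3 \<Rightarrow> (real \<Rightarrow> real) \<Rightarrow> bool" where
  "radial_tangency A f p g \<longleftrightarrow> smooth_positive_halfline g \<and>
     (\<forall>c\<in>A. \<forall>x\<in>fst c. dist p (f x) > 0 \<longrightarrow>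
        norm (surface_gradient (local_rep f c) (local_rep (\<lambda>x. dist p (f x)) c) (snd c x))
          \<ge> g (dist p (f x)))"

end

theory Submission
  imports Defs
begin

text \<open>On a radially mean convex surface \<open>\<Delta>r\<^sup>2 = 4 + 4\<langle>F - p, H\<rangle> \<le> 4\<close>. Let
  \<open>P(r) = \<integral>\<^sub>\<rho>\<^sup>r s e(s) ds\<close> with \<open>e(s) = exp (-\<integral>\<^sub>\<rho>\<^sup>s 2/(t g\<^sup>2))\<close>. As a function of \<open>r\<^sup>2\<close>, it satisfies
  \<open>\<Delta>P(r) = (e/2)(\<Delta>r\<^sup>2 - |\<nabla>r\<^sup>2|\<^sup>2/(r\<^sup>2g\<^sup>2)) \<le> 2e (1 - |\<nabla>r|\<^sup>2/g\<^sup>2) \<le> 0\<close>, so that \<open>P \<circ> r\<close> is superharmonic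
  for \<open>r > 0\<close>. If the integral diverges, then \<open>P \<circ> r\<close> is also proper. For a subharmonic \<open>u\<close> bounded
  above, \<open>u - \<epsilon> P(r)\<close> then attains its maximum on the region outside a compact set \<open>K\<close>; by the strong
  maximum principle and connectedness it cannot exceed there the maximum of \<open>u\<close> on \<open>K\<close>. As
  \<open>\<epsilon> \<rightarrow> 0\<close>, \<open>u\<close> attains its global maximum on \<open>K\<close> and is constant, again by the strong maximum
  principle: the surface is parabolic.\<close>

subsection \<open>The strong maximum principle for elliptic operators\<close>

text \<open>The weight in \<open>e\<close> is dictated by the worst case
  \<open>|grad r| = g\<close>. Put \<open>q = r^2\<close> and \<open>\<phi>(q) = P(sqrt q)\<close>:
  convexity bounds the first-order term of the Laplacian by \<open>4 \<phi>'\<close>, tangency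
  bounds the second-order term by \<open>4 q g^2 \<phi>''\<close>, and
  \<open>\<phi>'' = - \<phi>' / (q g^2)\<close> is the equation that makes the two bounds cancel.
  The variable \<open>q\<close> is preferred to \<open>r\<close> because it is polynomial in the
  immersion, so that its Laplacian brings in the mean curvature vector directly. Two obstacles shape
  the rest. The Laplacian is given in divergence form, while Hopf's barrier acts on a non-divergence
  operator with continuous coefficients and definite principal part; this is why the operator is
  rewritten in coordinates. Moreover superharmonicity is available only for \<open>r > 0\<close>,
  and the region outside a compact set may be disconnected with an irregular boundary. The potential
  is therefore frozen below a radius \<open>R\<close>, and the maximum set of the resulting
  continuous function is shown to be open and closed in the whole surface, which replaces any
  analysis at the boundary.\<close>

lemma interior_max_derivs:
  fixes w :: "'a::euclidean_space \<Rightarrow> real"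
  assumes S: "open S" "y \<in> S" and max: "\<And>x. x \<in> S \<Longrightarrow> w x \<le> w y"
    and w1: "\<And>x. x \<in> S \<Longrightarrow> (w has_derivative (\<lambda>h. Dw x \<bullet> h)) (at x)"
    and w2: "(Dw has_derivative H) (at y)"
  shows "Dw y = 0" and "H v \<bullet> v \<le> 0"
proof -
  have "(\<lambda>h. Dw y \<bullet> h) = (\<lambda>h. 0)"
    by (rule differential_zero_maxmin[OF S(2,1) w1[OF S(2)]]) (use max in auto)
  then have "Dw y \<bullet> Dw y = 0" by meson
  then show D0: "Dw y = 0" by simp
  show "H v \<bullet> v \<le> 0"
  proof (rule ccontr)
    assume neg: "\<not> ?thesis"
    \<comment> \<open>Restrict to the line through \<open>y\<close> in direction \<open>v\<close>:
      the derivative \<open>\<phi>'\<close> vanishes at 0 and would be positive just to the right of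
      it, so the mean value theorem produces a value above \<open>w y\<close>.\<close>
    define l where "l t = y + t *\<^sub>R v" for t :: real
    define \<phi>' where "\<phi>' t = Dw (l t) \<bullet> v" for t
    have l': "(l has_derivative (\<lambda>t. t *\<^sub>R v)) (at t)" for t
      unfolding l_def by (auto intro!: derivative_eq_intros)
    have l0: "l 0 = y" by (simp add: l_def)
    interpret H: linear H using w2 has_derivative_linear by blast
    have "((\<lambda>t. Dw (l t)) has_derivative (\<lambda>t. H (t *\<^sub>R v))) (at 0)"
      by (rule has_derivative_compose[OF l']) (use w2 l0 in simp)
    then have "(\<phi>' has_derivative (\<lambda>t. H (t *\<^sub>R v) \<bullet> v)) (at 0)"
      unfolding \<phi>'_def by (auto intro!: derivative_eq_intros)
    then have "DERIV \<phi>' 0 :> H v \<bullet> v"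
      by (rule has_derivative_imp_has_field_derivative) (simp add: H.scaleR)
    then obtain d where d: "d > 0" "\<And>h. 0 < h \<Longrightarrow> h < d \<Longrightarrow> \<phi>' 0 < \<phi>' (0 + h)"
      using DERIV_pos_inc_right[of \<phi>' "H v \<bullet> v" 0] neg by auto
    have "open (l -` S)"
      by (rule continuous_open_vimage[OF S(1)])
         (use l' has_derivative_continuous in blast)
    then obtain e where e: "e > 0" "ball 0 e \<subseteq> l -` S"
      using S(2) l0 by (metis openE vimage_eq)
    define t where "t = min d e / 2"
    have t: "0 < t" "t < d" "t < e" using d e by (auto simp: t_def)
    have inS: "l s \<in> S" if "0 \<le> s" "s \<le> t" for s
      using e(2) that t by (auto simp: subset_iff dist_real_def)
    have "DERIV (\<lambda>s. w (l s)) s :> \<phi>' s" if "0 \<le> s" "s \<le> t" for s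
    proof -
      have "((\<lambda>s. w (l s)) has_derivative (\<lambda>r. Dw (l s) \<bullet> (r *\<^sub>R v))) (at s)"
        by (rule has_derivative_compose[OF l' w1[OF inS[OF that]]])
      then show ?thesis
        by (rule has_derivative_imp_has_field_derivative) (simp add: \<phi>'_def)
    qed
    then obtain z where z: "0 < z" "z < t" "w (l t) - w (l 0) = (t - 0) * \<phi>' z"
      using MVT2[of 0 t "\<lambda>s. w (l s)" \<phi>'] t by metis
    have "\<phi>' z > 0" using d(2)[of z] z t D0 l0 by (simp add: \<phi>'_def)
    then have "w (l t) > w y" using z t l0 by (simp add: algebra_simps)
    then show False using max[OF inS[of t]] t by simp
  qed
qed

text \<open>The second-order part \<open>\<Sum>\<^sub>k D\<^sup>2w(V\<^sub>k, V\<^sub>k)\<close> encodes the coefficient matrix \<open>\<Sum>\<^sub>k V\<^sub>k V\<^sub>k\<^sup>T\<close>. Hopf's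
  barrier: a ball about \<open>c\<close> of radius \<open>R\<close> inside \<open>{w < w y0}\<close> touches \<open>{w = w y0}\<close> at a single
  point \<open>z\<close>; the function \<open>h\<close> below vanishes on its boundary sphere and is a strict subsolution
  near \<open>z\<close> once \<open>\<alpha>\<close> is large, so \<open>w + \<eta> h\<close> would have an interior maximum near \<open>z\<close>.\<close>

lemma strong_maximum_principle:
  fixes w :: "'a::euclidean_space \<Rightarrow> real" and V :: "'k \<Rightarrow> 'a \<Rightarrow> 'a"
  assumes S: "open S" "y0 \<in> S" and max: "\<And>x. x \<in> S \<Longrightarrow> w x \<le> w y0"
    and w1: "\<And>x. x \<in> S \<Longrightarrow> (w has_derivative (\<lambda>h. Dw x \<bullet> h)) (at x)"
    and w2: "\<And>x. x \<in> S \<Longrightarrow> (Dw has_derivative H x) (at x)"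
    and fin: "finite K"
    and V: "\<And>k. k \<in> K \<Longrightarrow> continuous_on S (V k)" and b: "continuous_on S b"
    and ell: "\<And>x v. x \<in> S \<Longrightarrow> v \<noteq> 0 \<Longrightarrow> \<exists>k\<in>K. V k x \<bullet> v \<noteq> 0"
    and sub: "\<And>x. x \<in> S \<Longrightarrow> (\<Sum>k\<in>K. H x (V k x) \<bullet> V k x) + b x \<bullet> Dw x \<ge> 0"
  shows "\<exists>e>0. ball y0 e \<subseteq> S \<and> (\<forall>x\<in>ball y0 e. w x = w y0)"
proof -
  \<comment> \<open>The doubled radius leaves room: if \<open>x\<close> is within \<open>e\<close>
    of \<open>y0\<close>, a ball about \<open>x\<close> of radius below \<open>e\<close> still lies
    in \<open>S\<close>.\<close>
  obtain e where e: "e > 0" "cball y0 (2 * e) \<subseteq> S"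
  proof -
    obtain e' where "e' > 0" "cball y0 e' \<subseteq> S" using S open_contains_cball by blast
    then show thesis using that[of "e'/2"] by auto
  qed
  have "w x = w y0" if x: "x \<in> ball y0 e" for x
  proof (rule ccontr)
    assume ne: "w x \<noteq> w y0"
    have cw: "continuous_on S w"
      by (rule has_derivative_continuous_on) (rule has_derivative_at_withinI, erule w1)
    define T where "T = cball y0 (2 * e) \<inter> w -` {w y0}"
    have "closed T" unfolding T_def
    proof -
      have "closedin (top_of_set (cball y0 (2*e))) (cball y0 (2*e) \<inter> w -` {w y0})"
        by (rule continuous_closedin_preimage) (use cw e continuous_on_subset in auto)
      then show "closed (cball y0 (2 * e) \<inter> w -` {w y0})"
        by (simp add: closedin_closed_eq)
    qed
    moreover have "y0 \<in> T" using e by (simp add: T_def)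
    ultimately obtain z where z: "z \<in> T" "\<And>z'. z' \<in> T \<Longrightarrow> dist x z \<le> dist x z'"
      using distance_attains_inf[of T x] by blast
    define d where "d = dist x z"
    have "d \<le> dist x y0" using z \<open>y0 \<in> T\<close> by (simp add: d_def)
    then have de: "d < e" using x by (simp add: dist_commute)
    have d0: "d > 0" using ne z by (auto simp: d_def T_def)
    have less: "w y < w y0" if "dist x y < d" for y
    proof -
      have "dist y0 y < 2 * e" using x de that dist_triangle[of y0 y x] by simp
      then have "y \<in> cball y0 (2*e)" "y \<notin> T" using z(2)[of y] that d_def by auto
      then show ?thesis using max[of y] e by (force simp: T_def)
    qed
    \<comment> \<open>The open ball of radius \<open>d\<close> about \<open>x\<close> misses the
      maximum set, but its boundary may meet that set in several points. The ball of half the radius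
      about the midpoint is internally tangent at \<open>z\<close>, hence touches the set only
      there.\<close>
    define c where "c = midpoint x z"
    define R where "R = d / 2"
    have R: "R > 0" "dist c z = R" using d0 by (auto simp: R_def c_def d_def dist_midpoint)
    have zint: "dist y0 z < 2 * e"
      using x de dist_triangle[of y0 z x] by (simp add: d_def)
    then have zS: "z \<in> S" using e by auto
    have less': "w y < w y0" if "dist c y \<le> R" "y \<noteq> z" for y
    proof -
      have xc: "x - c = c - z"
      proof -
        have "x = 2 *\<^sub>R c - z" by (simp add: c_def midpoint_def)
        then show ?thesis by (simp add: scaleR_2)
      qed
      have "dist x y < d"
      proof (rule ccontr)
        assume "\<not> dist x y < d"
        then have A: "norm ((x - c) + (c - y)) \<ge> 2 * R" by (simp add: dist_norm R_def)
        have B: "norm (x - c) = R" using R xc by (simp add: dist_norm)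
        have C: "norm (c - y) \<le> R" using that by (simp add: dist_norm)
        \<comment> \<open>Equality in the triangle inequality, with both lengths equal to
          \<open>R\<close>, forces \<open>c - y = x - c = c - z\<close>.\<close>
        have "norm ((x - c) + (c - y)) = norm (x - c) + norm (c - y)" "norm (c - y) = R"
          using A B C norm_triangle_ineq[of "x - c" "c - y"] by auto
        then have "R *\<^sub>R (c - y) = R *\<^sub>R (x - c)"
          using norm_triangle_eq[of "x - c" "c - y"] B by simp
        then have "c - y = c - z" using R xc by simp
        then show False using that by simp
      qed
      then show ?thesis by (rule less)
    qed
    \<comment> \<open>The operator applied to \<open>exp (- \<alpha> * |y - c|^2)\<close> gives
      \<open>2 * \<alpha> * E * (2 * \<alpha> * Q - N)\<close>. The form \<open>Q\<close> vanishes
      at \<open>c\<close>, so positivity can be arranged only near \<open>z\<close>, where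
      ellipticity makes \<open>Q\<close> positive.\<close>
    define Q where "Q y = (\<Sum>k\<in>K. (V k y \<bullet> (y - c))\<^sup>2)" for y
    define N where "N y = (\<Sum>k\<in>K. (norm (V k y))\<^sup>2) + b y \<bullet> (y - c)" for y
    have zc: "z - c \<noteq> 0" using R by auto
    have Qz: "Q z > 0"
    proof -
      obtain k where "k \<in> K" "V k z \<bullet> (z - c) \<noteq> 0" using ell[OF zS zc] by blast
      then show ?thesis unfolding Q_def by (intro sum_pos2[OF fin]) auto
    qed
    \<comment> \<open>With this choice \<open>2 * \<alpha> * Q z = 2 * |N z| + 2\<close>, which
      exceeds \<open>N z\<close>.\<close>
    define \<alpha> where "\<alpha> = (\<bar>N z\<bar> + 1) / Q z"
    have al: "\<alpha> > 0" using Qz by (simp add: \<alpha>_def add_nonneg_pos)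
    have pos_z: "2 * \<alpha> * Q z - N z > 0"
      using Qz by (simp add: \<alpha>_def)
    have "continuous_on S (\<lambda>y. 2 * \<alpha> * Q y - N y)"
      unfolding Q_def N_def by (intro continuous_intros V b)
    then have "open (S \<inter> (\<lambda>y. 2 * \<alpha> * Q y - N y) -` {0<..})"
      using continuous_open_preimage[OF _ S(1)] open_greaterThan by metis
    moreover have "z \<in> S \<inter> (\<lambda>y. 2 * \<alpha> * Q y - N y) -` {0<..}" using zS pos_z by simp
    ultimately obtain s where s: "s > 0" "cball z s \<subseteq> S \<inter> (\<lambda>y. 2 * \<alpha> * Q y - N y) -` {0<..}"
      using open_contains_cball by meson
    define E where "E y = exp (- \<alpha> * ((y - c) \<bullet> (y - c)))" for y
    define h where "h y = E y - exp (- \<alpha> * R\<^sup>2)" for y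
    define h1 where "h1 y = (- 2 * \<alpha> * E y) *\<^sub>R (y - c)" for y
    define h2 where "h2 y v = (- 2 * \<alpha> * E y) *\<^sub>R v +
        (- 2 * \<alpha> * (E y * (- \<alpha> * (2 * ((y - c) \<bullet> v))))) *\<^sub>R (y - c)" for y v
    have dE: "(E has_derivative (\<lambda>v. E y * (- \<alpha> * (2 * ((y - c) \<bullet> v))))) (at y)" for y
    proof -
      have "((\<lambda>y. (y - c) \<bullet> (y - c)) has_derivative (\<lambda>v. 2 * ((y - c) \<bullet> v))) (at y)"
        by (auto intro!: derivative_eq_intros simp: inner_commute fun_eq_iff)
      from has_derivative_exp[OF has_derivative_mult_right[OF this, of "- \<alpha>"]]
      show ?thesis unfolding E_def by (simp add: mult_ac)
    qed
    have dh: "(h has_derivative (\<lambda>v. h1 y \<bullet> v)) (at y)" for y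
      unfolding h_def using has_derivative_diff[OF dE has_derivative_const]
      by (simp add: h1_def mult_ac)
    have dh1: "(h1 has_derivative h2 y) (at y)" for y
    proof -
      have "((\<lambda>y. y - c) has_derivative (\<lambda>v. v)) (at y)"
        by (auto intro!: derivative_eq_intros)
      from has_derivative_scaleR[OF has_derivative_mult_right[OF dE, of "- 2 * \<alpha>"] this]
      show ?thesis unfolding h1_def h2_def .
    qed
    have Lh: "(\<Sum>k\<in>K. h2 y (V k y) \<bullet> V k y) + b y \<bullet> h1 y > 0" if "y \<in> cball z s" for y
    proof -
      have "h2 y (V k y) \<bullet> V k y =
        2 * \<alpha> * E y * (2 * \<alpha> * (V k y \<bullet> (y - c))\<^sup>2 - (norm (V k y))\<^sup>2)" for k
        unfolding h2_def power2_norm_eq_inner power2_eq_square inner_add_left inner_scaleR_left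
          inner_commute[of "y - c" "V k y"]
        by (simp add: right_diff_distrib dot_square_norm power2_eq_square)
      then have "(\<Sum>k\<in>K. h2 y (V k y) \<bullet> V k y) =
        2 * \<alpha> * E y * (2 * \<alpha> * Q y - (\<Sum>k\<in>K. (norm (V k y))\<^sup>2))"
        unfolding Q_def by (simp add: sum_distrib_left[symmetric] sum_subtractf)
      moreover have "b y \<bullet> h1 y = - 2 * \<alpha> * E y * (b y \<bullet> (y - c))"
        by (simp add: h1_def)
      ultimately have "(\<Sum>k\<in>K. h2 y (V k y) \<bullet> V k y) + b y \<bullet> h1 y =
        2 * \<alpha> * E y * (2 * \<alpha> * Q y - N y)"
        unfolding N_def by (simp add: right_diff_distrib distrib_left)
      moreover have "E y > 0" by (simp add: E_def)
      moreover have "2 * \<alpha> * Q y - N y > 0" using that s(2) by auto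
      ultimately show ?thesis using al by simp
    qed
    \<comment> \<open>The sphere about \<open>z\<close> is split by \<open>cball c R\<close>. On the
      inner part, a compact set avoiding \<open>z\<close>, there is a gap \<open>\<eta>\<close>
      below the maximum, and \<open>h < 1\<close> keeps \<open>\<eta> * h\<close> from closing it;
      on the outer part \<open>h\<close> is negative. Since \<open>W z = w y0\<close>, the maximum
      of \<open>W\<close> over the closed ball is interior.\<close>
    define T' where "T' = sphere z s \<inter> cball c R"
    have spS: "sphere z s \<subseteq> S" using s by force
    obtain \<eta> where eta: "\<eta> > 0" "\<And>y. y \<in> T' \<Longrightarrow> w y \<le> w y0 - \<eta>"
    proof (cases "T' = {}")
      case True then show thesis using that[of 1] by simp
    next
      case False
      have "compact T'" unfolding T'_def by (simp add: compact_Int)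
      then obtain m where m: "m \<in> T'" "\<And>y. y \<in> T' \<Longrightarrow> w y \<le> w m"
        using continuous_attains_sup[of T' w] False cw spS T'_def
        by (metis continuous_on_subset inf.coboundedI1)
      have "w m < w y0" using less'[of m] m(1) s by (auto simp: T'_def)
      then show thesis using that[of "w y0 - w m"] m(2) by force
    qed
    have hle: "h y < 1" for y
    proof -
      have "exp (- \<alpha> * ((y - c) \<bullet> (y - c))) \<le> 1" using al by simp
      then show ?thesis unfolding h_def E_def using exp_gt_zero[of "- \<alpha> * R\<^sup>2"] by linarith
    qed
    define W where "W y = w y + \<eta> * h y" for y
    have hz: "h z = 0" using R by (simp add: h_def E_def dot_square_norm dist_norm norm_minus_commute)
    have Wz: "W z = w y0" using hz z by (simp add: W_def T_def)
    have Wsp: "W y < w y0" if "y \<in> sphere z s" for y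
    proof (cases "dist c y \<le> R")
      case True
      then have "y \<in> T'" using that by (simp add: T'_def)
      then have "w y \<le> w y0 - \<eta>" by (rule eta)
      moreover have "\<eta> * h y < \<eta>" using hle eta by simp
      ultimately show ?thesis by (simp add: W_def)
    next
      case False
      then have "R\<^sup>2 < (norm (y - c))\<^sup>2" using R by (intro power_strict_mono) (auto simp: dist_norm norm_minus_commute)
      then have "h y < 0" using al by (simp add: h_def E_def dot_square_norm)
      then have "\<eta> * h y < 0" using eta by (simp add: mult_pos_neg)
      then show ?thesis using max[of y] spS that by (force simp: W_def)
    qed
    have "continuous_on (cball z s) W" unfolding W_def h_def E_def
      by (intro continuous_intros continuous_on_subset[OF cw]) (use s in auto)
    then obtain m where m: "m \<in> cball z s" "\<And>y. y \<in> cball z s \<Longrightarrow> W y \<le> W m"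
      using continuous_attains_sup[of "cball z s" W] s by auto
    have mb: "m \<in> ball z s" using m(2)[of z] Wsp[of m] Wz m(1) s by force
    have dW: "(W has_derivative (\<lambda>v. (Dw y + \<eta> *\<^sub>R h1 y) \<bullet> v)) (at y)" if "y \<in> ball z s" for y
    proof -
      have "y \<in> S" using that s by force
      then show ?thesis unfolding W_def
        by (auto intro!: derivative_eq_intros w1 dh simp: inner_add_left)
    qed
    have dW2: "((\<lambda>y. Dw y + \<eta> *\<^sub>R h1 y) has_derivative (\<lambda>v. H m v + \<eta> *\<^sub>R h2 m v)) (at m)"
      using m s by (auto intro!: derivative_eq_intros w2 dh1)
    note M = interior_max_derivs[of "ball z s" m W "\<lambda>y. Dw y + \<eta> *\<^sub>R h1 y", OF _ mb _ dW dW2]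
    have M1: "Dw m + \<eta> *\<^sub>R h1 m = 0" using M(1) m(2) by simp
    have M2: "(H m v + \<eta> *\<^sub>R h2 m v) \<bullet> v \<le> 0" for v using M(2) m(2) by simp
    \<comment> \<open>By linearity the operator on \<open>W\<close> is a nonnegative term from
      \<open>w\<close> plus a strictly positive one from \<open>\<eta> * h\<close>, yet the interior
      maximum makes it nonpositive.\<close>
    have "(\<Sum>k\<in>K. H m (V k m) \<bullet> V k m) + b m \<bullet> Dw m + \<eta> * ((\<Sum>k\<in>K. h2 m (V k m) \<bullet> V k m) + b m \<bullet> h1 m)
      = (\<Sum>k\<in>K. (H m (V k m) + \<eta> *\<^sub>R h2 m (V k m)) \<bullet> V k m) + b m \<bullet> (Dw m + \<eta> *\<^sub>R h1 m)"
      by (simp add: inner_add_left inner_add_right sum.distrib sum_distrib_left distrib_left)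
    also have "\<dots> \<le> 0" using M1 M2 by (simp add: sum_nonpos)
    finally have "(\<Sum>k\<in>K. H m (V k m) \<bullet> V k m) + b m \<bullet> Dw m + \<eta> * ((\<Sum>k\<in>K. h2 m (V k m) \<bullet> V k m) + b m \<bullet> h1 m) \<le> 0" .
    moreover have "\<eta> * ((\<Sum>k\<in>K. h2 m (V k m) \<bullet> V k m) + b m \<bullet> h1 m) > 0"
      using Lh[OF m(1)] eta by simp
    moreover have "m \<in> S" using m s by auto
    ultimately show False using sub[of m] by linarith
  qed
  moreover have "ball y0 e \<subseteq> S" using e by force
  ultimately show ?thesis using e by blast
qed

subsection \<open>Second-order calculus in the plane\<close>

text \<open>Two applications of the mean value theorem: first in \<open>s\<close> to the difference
  \<open>f s b - f s 0\<close>, then in \<open>t\<close> to \<open>f1 \<sigma>\<close>. Exchanging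
  the variables expresses the same second difference by the other mixed derivative.\<close>

lemma second_difference_mvt:
  fixes f :: "real \<Rightarrow> real \<Rightarrow> real"
  assumes "a > 0" "b > 0"
    and f1: "\<And>s t. 0 \<le> s \<Longrightarrow> s \<le> a \<Longrightarrow> 0 \<le> t \<Longrightarrow> t \<le> b \<Longrightarrow> ((\<lambda>s. f s t) has_real_derivative f1 s t) (at s)"
    and f12: "\<And>s t. 0 \<le> s \<Longrightarrow> s \<le> a \<Longrightarrow> 0 \<le> t \<Longrightarrow> t \<le> b \<Longrightarrow> ((\<lambda>t. f1 s t) has_real_derivative f12 s t) (at t)"
  obtains \<sigma> \<tau> where "0 < \<sigma>" "\<sigma> < a" "0 < \<tau>" "\<tau> < b"
    "f a b - f a 0 - f 0 b + f 0 0 = a * b * f12 \<sigma> \<tau>"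
proof -
  have "((\<lambda>s. f s b - f s 0) has_real_derivative f1 s b - f1 s 0) (at s)" if "0 \<le> s" "s \<le> a" for s
    using that assms by (intro DERIV_diff f1) auto
  then obtain \<sigma> where s: "0 < \<sigma>" "\<sigma> < a"
      "(f a b - f a 0) - (f 0 b - f 0 0) = (a - 0) * (f1 \<sigma> b - f1 \<sigma> 0)"
    using MVT2[of 0 a "\<lambda>s. f s b - f s 0" "\<lambda>s. f1 s b - f1 s 0"] assms(1) by blast
  obtain \<tau> where "0 < \<tau>" "\<tau> < b" "f1 \<sigma> b - f1 \<sigma> 0 = (b - 0) * f12 \<sigma> \<tau>"
    using MVT2[of 0 b "f1 \<sigma>" "f12 \<sigma>"] f12 s assms(2) by (metis less_imp_le)
  with s show thesis by (intro that) auto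
qed

text \<open>One second difference over a small parallelogram equals \<open>a * a\<close> times
  either mixed derivative, each at some point of the parallelogram; continuity at \<open>x\<close>
  then identifies the two values.\<close>

lemma mixed_derivatives_commute:
  fixes F :: "'a::real_normed_vector \<Rightarrow> real"
  assumes S: "open S" "x \<in> S"
    and D: "\<And>z. z \<in> S \<Longrightarrow> (F has_derivative D z) (at z)"
    and Du: "\<And>z. z \<in> S \<Longrightarrow> ((\<lambda>z. D z u) has_derivative Du z) (at z)"
    and Dv: "\<And>z. z \<in> S \<Longrightarrow> ((\<lambda>z. D z v) has_derivative Dv z) (at z)"
    and c: "continuous_on S (\<lambda>z. Du z v)" "continuous_on S (\<lambda>z. Dv z u)"
  shows "Du x v = Dv x u"
proof (rule ccontr)
  assume ne: "\<not> ?thesis"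
  define \<epsilon> where "\<epsilon> = dist (Du x v) (Dv x u) / 2"
  have eps: "\<epsilon> > 0" using ne by (simp add: \<epsilon>_def)
  have "isCont (\<lambda>z. Du z v) x" "isCont (\<lambda>z. Dv z u) x"
    using c S by (auto simp: continuous_on_eq_continuous_at)
  then obtain d1 d2 where d: "d1 > 0" "d2 > 0" "\<And>z. dist z x < d1 \<Longrightarrow> dist (Du z v) (Du x v) < \<epsilon>"
     "\<And>z. dist z x < d2 \<Longrightarrow> dist (Dv z u) (Dv x u) < \<epsilon>"
    unfolding continuous_at_eps_delta by (metis eps)
  obtain d3 where d3: "d3 > 0" "ball x d3 \<subseteq> S" using S open_contains_ball by blast
  define d where "d = Min {d1, d2, d3}"
  have dd: "d > 0" "d \<le> d1" "d \<le> d2" "d \<le> d3" using d d3 by (auto simp: d_def)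
  \<comment> \<open>With this side length every \<open>l s t\<close> stays within \<open>d\<close>
    of \<open>x\<close>; the \<open>+ 1\<close> covers the case where \<open>u\<close> and
    \<open>v\<close> both vanish.\<close>
  define a where "a = d / (norm u + norm v + 1)"
  have a0: "a > 0" using dd by (simp add: a_def add_nonneg_pos)
  define l where "l s t = x + s *\<^sub>R u + t *\<^sub>R v" for s t :: real
  have near: "dist (l s t) x < d" if "0 \<le> s" "s \<le> a" "0 \<le> t" "t \<le> a" for s t
  proof -
    have "dist (l s t) x \<le> s * norm u + t * norm v"
      unfolding l_def dist_norm using norm_triangle_ineq[of "s *\<^sub>R u" "t *\<^sub>R v"] that
      by (simp add: add.assoc)
    also have "\<dots> \<le> a * norm u + a * norm v"
      using that by (intro add_mono mult_right_mono) auto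
    also have "\<dots> < a * (norm u + norm v + 1)" using a0 by (simp add: distrib_left)
    also have "\<dots> = d" unfolding a_def
      using add_nonneg_pos[of "norm u + norm v" 1] by simp
    finally show ?thesis .
  qed
  then have inS: "l s t \<in> S" if "0 \<le> s" "s \<le> a" "0 \<le> t" "t \<le> a" for s t
    using d3(2) dd(4) that by (force simp: dist_commute)
  have ls: "((\<lambda>s. l s t) has_derivative (\<lambda>h. h *\<^sub>R u)) (at s)"
    and lt: "((\<lambda>t. l s t) has_derivative (\<lambda>h. h *\<^sub>R v)) (at t)" for s t
    unfolding l_def by (auto intro!: derivative_eq_intros)
  have chs: "((\<lambda>s. G (l s t)) has_real_derivative G' u) (at s)"
    and cht: "((\<lambda>t. G (l s t)) has_real_derivative G' v) (at t)"
    if G: "(G has_derivative G') (at (l s t))" for G G' s t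
  proof -
    interpret G: linear G' using G has_derivative_linear by blast
    show "((\<lambda>s. G (l s t)) has_real_derivative G' u) (at s)"
      by (rule has_derivative_imp_has_field_derivative[OF has_derivative_compose[OF ls G]])
         (simp add: G.scaleR)
    show "((\<lambda>t. G (l s t)) has_real_derivative G' v) (at t)"
      by (rule has_derivative_imp_has_field_derivative[OF has_derivative_compose[OF lt G]])
         (simp add: G.scaleR)
  qed
  obtain \<sigma> \<tau> where 1: "0 < \<sigma>" "\<sigma> < a" "0 < \<tau>" "\<tau> < a"
    "F (l a a) - F (l a 0) - F (l 0 a) + F (l 0 0) = a * a * Du (l \<sigma> \<tau>) v"
    by (rule second_difference_mvt[of a a "\<lambda>s t. F (l s t)" "\<lambda>s t. D (l s t) u" "\<lambda>s t. Du (l s t) v"])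
       (use a0 in \<open>auto intro!: chs[OF D] cht[OF Du] inS\<close>)
  obtain \<tau>' \<sigma>' where 2: "0 < \<tau>'" "\<tau>' < a" "0 < \<sigma>'" "\<sigma>' < a"
    "F (l a a) - F (l 0 a) - F (l a 0) + F (l 0 0) = a * a * Dv (l \<sigma>' \<tau>') u"
    by (rule second_difference_mvt[of a a "\<lambda>t s. F (l s t)" "\<lambda>t s. D (l s t) v" "\<lambda>t s. Dv (l s t) u"])
       (use a0 in \<open>auto intro!: cht[OF D] chs[OF Dv] inS\<close>)
  have "a * a * Du (l \<sigma> \<tau>) v = a * a * Dv (l \<sigma>' \<tau>') u" using 1 2 by linarith
  then have eq: "Du (l \<sigma> \<tau>) v = Dv (l \<sigma>' \<tau>') u" using a0 by simp
  have "dist (Du (l \<sigma> \<tau>) v) (Du x v) < \<epsilon>" "dist (Dv (l \<sigma>' \<tau>') u) (Dv x u) < \<epsilon>"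
    using d(3)[of "l \<sigma> \<tau>"] d(4)[of "l \<sigma>' \<tau>'"] near[of \<sigma> \<tau>] near[of \<sigma>' \<tau>'] 1 2 dd by auto
  then have "dist (Du x v) (Dv x u) < \<epsilon> + \<epsilon>"
    using eq dist_triangle_less_add[of "Du x v" "Du (l \<sigma> \<tau>) v" \<epsilon> "Dv x u" \<epsilon>] by (simp add: dist_commute)
  then show False by (simp add: \<epsilon>_def)
qed

text \<open>The derivatives are carried as data, with \<open>w2 i j\<close> the \<open>j\<close>-th
  partial of the \<open>i\<close>-th partial, and neither symmetry nor continuity is built in.
  Compositions and differences then have explicit jets, to which the coordinate Laplacian applies
  directly.\<close>

definition two_jet :: "(real^2) set \<Rightarrow> (real^2 \<Rightarrow> 'b::real_normed_vector) \<Rightarrow> (2 \<Rightarrow> real^2 \<Rightarrow> 'b) \<Rightarrow>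
    (2 \<Rightarrow> 2 \<Rightarrow> real^2 \<Rightarrow> 'b) \<Rightarrow> bool" where
  "two_jet S w w1 w2 \<longleftrightarrow> (\<forall>x\<in>S.
     (w has_derivative (\<lambda>h. h$1 *\<^sub>R w1 1 x + h$2 *\<^sub>R w1 2 x)) (at x) \<and>
     (\<forall>i. (w1 i has_derivative (\<lambda>h. h$1 *\<^sub>R w2 i 1 x + h$2 *\<^sub>R w2 i 2 x)) (at x)))"

lemma two_jetD:
  assumes "two_jet S w w1 w2" "x \<in> S"
  shows "(w has_derivative (\<lambda>h. h$1 *\<^sub>R w1 1 x + h$2 *\<^sub>R w1 2 x)) (at x)"
    "(w1 i has_derivative (\<lambda>h. h$1 *\<^sub>R w2 i 1 x + h$2 *\<^sub>R w2 i 2 x)) (at x)"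
  using assms by (auto simp: two_jet_def)

lemma two_jet_subset: "two_jet S w w1 w2 \<Longrightarrow> T \<subseteq> S \<Longrightarrow> two_jet T w w1 w2"
  by (auto simp: two_jet_def)

lemma axis_2_nth [simp]:
  "(axis 1 x :: 'a::zero^2) $ 1 = x" "(axis 1 x :: 'a^2) $ 2 = 0"
  "(axis 2 x :: 'a^2) $ 1 = 0" "(axis 2 x :: 'a^2) $ 2 = x"
  by (auto simp: axis_def)

lemma vec_2_expansion: "(h :: real^2) = h$1 *\<^sub>R axis 1 1 + h$2 *\<^sub>R axis 2 1"
  by (simp add: vec_eq_iff forall_2)

lemma partial_eqI:
  assumes "(F has_derivative D) (at y)"
  shows "partial F i y = D (axis i 1)"
  using frechet_derivative_at[OF assms] by (simp add: partial_def)

lemma partial_cong_open: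
  assumes "open S" "y \<in> S" "\<And>z. z \<in> S \<Longrightarrow> F z = G z"
  shows "partial F i y = partial G i y"
proof -
  have "(F has_derivative D) (at y) \<longleftrightarrow> (G has_derivative D) (at y)" for D
    using has_derivative_transform_within_open[of _ D y UNIV S] assms by metis
  then show ?thesis by (simp add: partial_def frechet_derivative_def)
qed

lemma two_jet_partial:
  assumes "two_jet S w w1 w2" "x \<in> S"
  shows "partial w i x = w1 i x" "partial (w1 i) j x = w2 i j x"
  using partial_eqI[OF two_jetD(1)[OF assms], of i] partial_eqI[OF two_jetD(2)[OF assms], of i j]
    exhaust_2[of i] exhaust_2[of j] by auto

lemma differentiable_partials:
  assumes "F differentiable (at x)"
  shows "(F has_derivative (\<lambda>h. h$1 *\<^sub>R partial F 1 x + h$2 *\<^sub>R partial F 2 x)) (at x)"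
proof -
  have D: "(F has_derivative frechet_derivative F (at x)) (at x)"
    using assms frechet_derivative_works by blast
  interpret linear "frechet_derivative F (at x)" using D has_derivative_linear by blast
  have "frechet_derivative F (at x) h = h$1 *\<^sub>R partial F 1 x + h$2 *\<^sub>R partial F 2 x" for h
    by (subst vec_2_expansion[of h]) (simp add: partial_def add scaleR)
  then show ?thesis using D by presburger
qed

lemma Ck_on_partial: "Ck_on (Suc k) F S \<Longrightarrow> Ck_on k (partial F i) S"
  by (simp add: partial_def[abs_def])

lemma Ck_on_2_two_jet:
  assumes "Ck_on 2 F S"
  shows "two_jet S F (partial F) (\<lambda>i j. partial (partial F i) j)"
    and "continuous_on S (partial (partial F i) j)"
proof -
  have F: "Ck_on (Suc (Suc 0)) F S" using assms by (simp add: numeral_2_eq_2)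
  show "continuous_on S (partial (partial F i) j)"
    using Ck_on_partial[OF Ck_on_partial[OF F]] by simp
  have "\<forall>x\<in>S. F differentiable (at x)" using F by simp
  moreover have "\<forall>x\<in>S. partial F i differentiable (at x)" for i
    using Ck_on_partial[OF F] by simp
  ultimately show "two_jet S F (partial F) (\<lambda>i j. partial (partial F i) j)"
    by (auto simp: two_jet_def intro: differentiable_partials)
qed

lemma two_jet_symmetric:
  fixes F :: "real^2 \<Rightarrow> 'b::euclidean_space"
  assumes S: "open S" "x \<in> S" and F: "two_jet S F X Y" and c: "\<And>i j. continuous_on S (Y i j)"
  shows "Y 1 2 x = Y 2 1 x"
proof (rule euclidean_eqI)
  fix b :: 'b assume "b \<in> Basis"
  have 1: "((\<lambda>z. F z \<bullet> b) has_derivative (\<lambda>h. (h$1 *\<^sub>R X 1 z + h$2 *\<^sub>R X 2 z) \<bullet> b)) (at z)" if "z \<in> S" for z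
    using has_derivative_inner_left[OF two_jetD(1)[OF F that]] .
  have 2: "((\<lambda>z. X i z \<bullet> b) has_derivative (\<lambda>h. (h$1 *\<^sub>R Y i 1 z + h$2 *\<^sub>R Y i 2 z) \<bullet> b)) (at z)" if "z \<in> S" for z i
    using has_derivative_inner_left[OF two_jetD(2)[OF F that]] .
  have 3: "continuous_on S (\<lambda>z. Y i j z \<bullet> b)" for i j by (intro continuous_intros c)
  show "Y 1 2 x \<bullet> b = Y 2 1 x \<bullet> b"
    using mixed_derivatives_commute[OF S 1, of "axis 1 1"
       "\<lambda>z h. (h$1 *\<^sub>R Y 1 1 z + h$2 *\<^sub>R Y 1 2 z) \<bullet> b" "axis 2 1" "\<lambda>z h. (h$1 *\<^sub>R Y 2 1 z + h$2 *\<^sub>R Y 2 2 z) \<bullet> b"]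
      2[of _ 1] 2[of _ 2] 3[of 1 2] 3[of 2 1] by simp
qed

text \<open>\<open>matrix_inv\<close> is a Hilbert choice, so the adjugate quotient \<open>B\<close>
  serves twice: as a witness that an inverse exists, and as the value, by uniqueness of
  inverses.\<close>

lemma matrix_inv_2:
  fixes A :: "real^2^2"
  assumes "det A \<noteq> 0"
  shows "matrix_inv A $ 1 $ 1 = A$2$2 / det A" "matrix_inv A $ 1 $ 2 = - A$1$2 / det A"
    "matrix_inv A $ 2 $ 1 = - A$2$1 / det A" "matrix_inv A $ 2 $ 2 = A$1$1 / det A"
proof -
  define B :: "real^2^2" where "B = (\<chi> i j. (if i = 1 then (if j = 1 then A$2$2 else - A$1$2)
     else (if j = 1 then - A$2$1 else A$1$1)) / det A)"
  have B: "B$1$1 = A$2$2 / det A" "B$1$2 = - A$1$2 / det A" "B$2$1 = - A$2$1 / det A" "B$2$2 = A$1$1 / det A"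
    by (auto simp: B_def)
  have AB: "A ** B = mat 1" "B ** A = mat 1"
    using assms unfolding vec_eq_iff forall_2 matrix_matrix_mult_def mat_def
    by (auto simp: sum_2 B det_2 diff_divide_distrib[symmetric] mult.commute)
  have I: "A ** matrix_inv A = mat 1 \<and> matrix_inv A ** A = mat 1"
    unfolding matrix_inv_def by (rule someI[of _ B]) (use AB in auto)
  have "matrix_inv A = matrix_inv A ** (A ** B)" using AB by simp
  also have "\<dots> = B" using I by (simp add: matrix_mul_assoc)
  finally have "matrix_inv A = B" .
  then show "matrix_inv A $ 1 $ 1 = A$2$2 / det A" "matrix_inv A $ 1 $ 2 = - A$1$2 / det A"
    "matrix_inv A $ 2 $ 1 = - A$2$1 / det A" "matrix_inv A $ 2 $ 2 = A$1$1 / det A"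
    using B by auto
qed

subsection \<open>The Laplace-Beltrami operator of an immersed patch\<close>

locale immersed_patch =
  fixes S :: "(real^2) set" and F :: "real^2 \<Rightarrow> real^3" and X :: "2 \<Rightarrow> real^2 \<Rightarrow> real^3"
    and Y :: "2 \<Rightarrow> 2 \<Rightarrow> real^2 \<Rightarrow> real^3"
  assumes S: "open S" and jet: "two_jet S F X Y"
    and Y_cont: "\<And>i j. continuous_on S (Y i j)"
    and independent: "\<And>y a b. y \<in> S \<Longrightarrow> a *\<^sub>R X 1 y + b *\<^sub>R X 2 y = 0 \<Longrightarrow> a = 0 \<and> b = 0"
begin

definition g11 where "g11 y = X 1 y \<bullet> X 1 y"
definition g12 where "g12 y = X 1 y \<bullet> X 2 y"
definition g22 where "g22 y = X 2 y \<bullet> X 2 y"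
definition D where "D y = g11 y * g22 y - (g12 y)\<^sup>2"

definition N where "N y = (g22 y / D y) *\<^sub>R Y 1 1 y - (2 * g12 y / D y) *\<^sub>R Y 1 2 y + (g11 y / D y) *\<^sub>R Y 2 2 y"

text \<open>\<open>b1\<close> and \<open>b2\<close> are the contracted Christoffel symbols with a
  minus sign, \<open>- g^kl <N, X l>\<close>: the coordinates of minus the tangential part of
  \<open>N\<close>.\<close>

definition b1 where "b1 y = (g12 y * (N y \<bullet> X 2 y) - g22 y * (N y \<bullet> X 1 y)) / D y"
definition b2 where "b2 y = (g12 y * (N y \<bullet> X 1 y) - g11 y * (N y \<bullet> X 2 y)) / D y"

text \<open>The Laplace-Beltrami operator in non-divergence form: the first-order coefficients \<open>b\<^sup>j\<close>
  turn \<open>N = g\<^sup>i\<^sup>j \<partial>\<^sub>i\<partial>\<^sub>jF\<close> into its normal part when the operator is applied to \<open>F\<close>.\<close>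

definition lap :: "(2 \<Rightarrow> real^2 \<Rightarrow> real) \<Rightarrow> (2 \<Rightarrow> 2 \<Rightarrow> real^2 \<Rightarrow> real) \<Rightarrow> real^2 \<Rightarrow> real" where
  "lap u1 u2 y = (g22 y * u2 1 1 y - g12 y * (u2 1 2 y + u2 2 1 y) + g11 y * u2 2 2 y) / D y
     + b1 y * u1 1 y + b2 y * u1 2 y"

lemma Y_sym: "y \<in> S \<Longrightarrow> Y 2 1 y = Y 1 2 y"
  using two_jet_symmetric[OF S _ jet Y_cont] by metis

lemma g11_pos: "y \<in> S \<Longrightarrow> g11 y > 0"
  using independent[of y 1 0] by (auto simp: g11_def)

text \<open>The vector \<open>?v\<close> is \<open>g11\<close> times the component of
  \<open>X 2\<close> orthogonal to \<open>X 1\<close>; it is nonzero by independence, and its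
  squared length is \<open>g11 * D\<close>.\<close>

lemma D_pos: assumes "y \<in> S" shows "D y > 0"
proof -
  let ?v = "g11 y *\<^sub>R X 2 y - g12 y *\<^sub>R X 1 y"
  have "?v \<noteq> 0" using independent[OF assms, of "- g12 y" "g11 y"] g11_pos[OF assms] by auto
  then have "?v \<bullet> ?v > 0" by simp
  also have "?v \<bullet> ?v = g11 y * D y"
    unfolding D_def by (simp add: inner_diff_left inner_diff_right inner_commute[of "X 2 y" "X 1 y"]
      g11_def[symmetric] g12_def[symmetric] g22_def[symmetric] algebra_simps power2_eq_square)
  finally show ?thesis using g11_pos[OF assms] by (simp add: zero_less_mult_iff)
qed

lemma first_form_entries:
  assumes "y \<in> S"
  shows "first_form F y $ 1 $ 1 = g11 y" "first_form F y $ 1 $ 2 = g12 y"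
    "first_form F y $ 2 $ 1 = g12 y" "first_form F y $ 2 $ 2 = g22 y"
    "det (first_form F y) = D y"
  using two_jet_partial[OF jet assms]
  by (auto simp: first_form_def g11_def g12_def g22_def D_def det_2 inner_commute power2_eq_square)

lemma inverse_form_entries:
  assumes "y \<in> S"
  shows "matrix_inv (first_form F y) $ 1 $ 1 = g22 y / D y"
    "matrix_inv (first_form F y) $ 1 $ 2 = - g12 y / D y"
    "matrix_inv (first_form F y) $ 2 $ 1 = - g12 y / D y"
    "matrix_inv (first_form F y) $ 2 $ 2 = g11 y / D y"
  using matrix_inv_2[of "first_form F y"] first_form_entries[OF assms] D_pos[OF assms] by auto

lemma metric_derivs:
  assumes y: "y \<in> S"
  shows "(g11 has_derivative (\<lambda>h. 2 * (h$1 * (Y 1 1 y \<bullet> X 1 y) + h$2 * (Y 1 2 y \<bullet> X 1 y)))) (at y)"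
    "(g12 has_derivative (\<lambda>h. h$1 * (Y 1 1 y \<bullet> X 2 y + Y 1 2 y \<bullet> X 1 y) + h$2 * (Y 1 2 y \<bullet> X 2 y + Y 2 2 y \<bullet> X 1 y))) (at y)"
    "(g22 has_derivative (\<lambda>h. 2 * (h$1 * (Y 1 2 y \<bullet> X 2 y) + h$2 * (Y 2 2 y \<bullet> X 2 y)))) (at y)"
proof -
  have *: "((\<lambda>y. X i y \<bullet> X j y) has_derivative (\<lambda>h. X i y \<bullet> (h$1 *\<^sub>R Y j 1 y + h$2 *\<^sub>R Y j 2 y) +
      (h$1 *\<^sub>R Y i 1 y + h$2 *\<^sub>R Y i 2 y) \<bullet> X j y)) (at y)" for i j
    by (rule has_derivative_inner[OF two_jetD(2)[OF jet y] two_jetD(2)[OF jet y]])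
  note [simp] = inner_add_left inner_add_right inner_commute[of "X i y" "Y j k y" for i j k] Y_sym[OF y]
  have eq: "f = f' \<Longrightarrow> (g has_derivative f) (at y) \<Longrightarrow> (g has_derivative f') (at y)"
    for f f' :: "real^2 \<Rightarrow> real" and g by simp
  show "(g11 has_derivative (\<lambda>h. 2 * (h$1 * (Y 1 1 y \<bullet> X 1 y) + h$2 * (Y 1 2 y \<bullet> X 1 y)))) (at y)"
    unfolding g11_def[abs_def] by (rule eq[OF _ *]) (auto simp: fun_eq_iff)
  show "(g12 has_derivative (\<lambda>h. h$1 * (Y 1 1 y \<bullet> X 2 y + Y 1 2 y \<bullet> X 1 y) + h$2 * (Y 1 2 y \<bullet> X 2 y + Y 2 2 y \<bullet> X 1 y))) (at y)"
    unfolding g12_def[abs_def] by (rule eq[OF _ *]) (auto simp: fun_eq_iff distrib_left)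
  show "(g22 has_derivative (\<lambda>h. 2 * (h$1 * (Y 1 2 y \<bullet> X 2 y) + h$2 * (Y 2 2 y \<bullet> X 2 y)))) (at y)"
    unfolding g22_def[abs_def] by (rule eq[OF _ *]) (auto simp: fun_eq_iff)
qed

text \<open>The inverse metric is an adjugate divided by \<open>D\<close>, so the flux
  \<open>sqrt D * g^ij * u_j\<close> has the form \<open>P / sqrt D\<close>. The factor
  \<open>1 / sqrt D\<close> pulled out here combines with the prefactor of the Laplacian to
  \<open>1 / D\<close>.\<close>

lemma partial_flux:
  assumes y: "y \<in> S" and N: "(P has_derivative P') (at y)" and "(D has_derivative D') (at y)"
  shows "partial (\<lambda>z. P z / sqrt (D z)) i y =
    (P' (axis i 1) - P y * D' (axis i 1) / (2 * D y)) / sqrt (D y)"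
proof -
  have D: "D y > 0" using D_pos[OF y] .
  have "((\<lambda>z. sqrt (D z)) has_derivative (\<lambda>h. D' h * (inverse (sqrt (D y)) / 2))) (at y)"
    by (rule derivative_eq_intros assms | use D in simp)+
  from has_derivative_divide[OF N this]
  have "partial (\<lambda>z. P z / sqrt (D z)) i y =
    - P y * (inverse (sqrt (D y)) * (D' (axis i 1) * (inverse (sqrt (D y)) / 2)) * inverse (sqrt (D y))) +
    P' (axis i 1) / sqrt (D y)"
    using D by (subst partial_eqI) auto
  also have "\<dots> = (P' (axis i 1) - P y * D' (axis i 1) / (2 * D y)) / sqrt (D y)"
  proof -
    have "- a * (inverse s * (d * (inverse s / 2)) * inverse s) + c / s = (c - a * d / (2 * (s * s))) / s"
      if "s > 0" for a c d s :: real
      using that by (simp add: field_simps)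
    from this[of "sqrt (D y)"] show ?thesis using D by simp
  qed
  finally show ?thesis .
qed

text \<open>Expanding the divergence produces first derivatives of the metric. They are inner
  products of \<open>Y\<close> with \<open>X\<close>, and these recombine into \<open>b1\<close> and
  \<open>b2\<close>.\<close>

lemma laplace_beltrami_eq_lap:
  assumes U: "open U" "U \<subseteq> S" "y \<in> U" and u: "two_jet U u u1 u2"
  shows "laplace_beltrami (first_form F) u y = lap u1 u2 y"
proof -
  have y: "y \<in> S" using U by auto
  define P1 where "P1 z = g22 z * u1 1 z - g12 z * u1 2 z" for z
  define P2 where "P2 z = g11 z * u1 2 z - g12 z * u1 1 z" for z
  define D' where "D' h = g11 y * (2 * (h$1 * (Y 1 2 y \<bullet> X 2 y) + h$2 * (Y 2 2 y \<bullet> X 2 y))) +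
    2 * (h$1 * (Y 1 1 y \<bullet> X 1 y) + h$2 * (Y 1 2 y \<bullet> X 1 y)) * g22 y -
    2 * g12 y * (h$1 * (Y 1 1 y \<bullet> X 2 y + Y 1 2 y \<bullet> X 1 y) + h$2 * (Y 1 2 y \<bullet> X 2 y + Y 2 2 y \<bullet> X 1 y))" for h :: "real^2"
  note m = metric_derivs[OF y]
  have D': "(D has_derivative D') (at y)"
    unfolding D_def[abs_def] D'_def[abs_def]
    by (rule derivative_eq_intros m refl)+ (simp add: fun_eq_iff)
  have P: "(P1 has_derivative (\<lambda>h. g22 y * (h$1 *\<^sub>R u2 1 1 y + h$2 *\<^sub>R u2 1 2 y) +
       2 * (h$1 * (Y 1 2 y \<bullet> X 2 y) + h$2 * (Y 2 2 y \<bullet> X 2 y)) * u1 1 y -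
       (g12 y * (h$1 *\<^sub>R u2 2 1 y + h$2 *\<^sub>R u2 2 2 y) +
       (h$1 * (Y 1 1 y \<bullet> X 2 y + Y 1 2 y \<bullet> X 1 y) + h$2 * (Y 1 2 y \<bullet> X 2 y + Y 2 2 y \<bullet> X 1 y)) * u1 2 y))) (at y)"
    unfolding P1_def[abs_def]
    by (intro has_derivative_diff has_derivative_mult m two_jetD(2)[OF u U(3)])
  have Q: "(P2 has_derivative (\<lambda>h. g11 y * (h$1 *\<^sub>R u2 2 1 y + h$2 *\<^sub>R u2 2 2 y) +
       2 * (h$1 * (Y 1 1 y \<bullet> X 1 y) + h$2 * (Y 1 2 y \<bullet> X 1 y)) * u1 2 y -
       (g12 y * (h$1 *\<^sub>R u2 1 1 y + h$2 *\<^sub>R u2 1 2 y) +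
       (h$1 * (Y 1 1 y \<bullet> X 2 y + Y 1 2 y \<bullet> X 1 y) + h$2 * (Y 1 2 y \<bullet> X 2 y + Y 2 2 y \<bullet> X 1 y)) * u1 1 y))) (at y)"
    unfolding P2_def[abs_def]
    by (intro has_derivative_diff has_derivative_mult m two_jetD(2)[OF u U(3)])
  have sq: "sqrt d * a / d = a / sqrt d" if "d > 0" for a d :: real
    using that by (simp add: field_simps)
  let ?G = "\<lambda>i z. sqrt (det (first_form F z)) * (\<Sum>j\<in>UNIV. matrix_inv (first_form F z) $ i $ j * partial u j z)"
  have "(\<Sum>i\<in>UNIV. partial (?G i) i y) = partial (?G 1) 1 y + partial (?G 2) 2 y"
    by (rule sum_2)
  also have "\<dots> = partial (\<lambda>z. P1 z / sqrt (D z)) 1 y + partial (\<lambda>z. P2 z / sqrt (D z)) 2 y"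
  proof (intro arg_cong2[where f = "(+)"] partial_cong_open[OF U(1,3)])
    fix z assume z: "z \<in> U"
    then have zS: "z \<in> S" using U by auto
    note s = sum_2 first_form_entries[OF zS] inverse_form_entries[OF zS] two_jet_partial[OF u z]
      sq[OF D_pos[OF zS]] distrib_left P1_def P2_def
    show "sqrt (det (first_form F z)) *
         (\<Sum>j\<in>UNIV. matrix_inv (first_form F z) $ 1 $ j * partial u j z) = P1 z / sqrt (D z)"
      by (simp add: s diff_divide_distrib right_diff_distrib)
    show "sqrt (det (first_form F z)) *
         (\<Sum>j\<in>UNIV. matrix_inv (first_form F z) $ 2 $ j * partial u j z) = P2 z / sqrt (D z)"
      by (simp add: s diff_divide_distrib right_diff_distrib)
  qed
  finally have flux: "(\<Sum>i\<in>UNIV. partial (?G i) i y) =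
      partial (\<lambda>z. P1 z / sqrt (D z)) 1 y + partial (\<lambda>z. P2 z / sqrt (D z)) 2 y" .
  have div: "1 / sqrt d * (a / sqrt d + b / sqrt d) = (a + b) / d" if "d > 0" for a b d :: real
  proof -
    have "1 / sqrt d * (a / sqrt d + b / sqrt d) = (a + b) / (sqrt d * sqrt d)"
      by (simp add: add_divide_distrib[symmetric] del: real_sqrt_mult_self)
    then show ?thesis using that by simp
  qed
  have LB: "laplace_beltrami (first_form F) u y =
   ((g22 y * u2 1 1 y + 2 * (Y 1 2 y \<bullet> X 2 y) * u1 1 y - (g12 y * u2 2 1 y + (Y 1 1 y \<bullet> X 2 y + Y 1 2 y \<bullet> X 1 y) * u1 2 y)
      - P1 y * D' (axis 1 1) / (2 * D y))
    + (g11 y * u2 2 2 y + 2 * (Y 1 2 y \<bullet> X 1 y) * u1 2 y - (g12 y * u2 1 2 y + (Y 1 2 y \<bullet> X 2 y + Y 2 2 y \<bullet> X 1 y) * u1 1 y)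
      - P2 y * D' (axis 2 1) / (2 * D y))) / D y"
    (is "_ = (?A + ?B) / _")
    unfolding laplace_beltrami_def flux first_form_entries[OF y]
      partial_flux[OF y P D'] partial_flux[OF y Q D'] div[OF D_pos[OF y]] axis_2_nth
    by (simp only: real_scaleR_def mult_1_left mult_zero_left mult_zero_right add_0_left add_0_right)
  \<comment> \<open>The geometry is stripped off to leave an identity of reals: \<open>p\<close>,
    \<open>q\<close>, \<open>r\<close> with index \<open>i\<close> are the inner products of
    \<open>Y 1 1\<close>, \<open>Y 1 2\<close>, \<open>Y 2 2\<close> with \<open>X i\<close>, while
    \<open>D1\<close>, \<open>D2\<close> are the partials of \<open>D\<close> and \<open>n1\<close>,
    \<open>n2\<close> the pairings of \<open>N\<close> with \<open>X\<close>. Multiplying by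
    \<open>d\<close> first makes the key step polynomial.\<close>
  have alg: "(g22 * u11 + 2 * q2 * v1 - (g12 * u21 + (p2 + q1) * v2) - (g22 * v1 - g12 * v2) * D1 / (2 * d))
     + (g11 * u22 + 2 * q1 * v2 - (g12 * u12 + (q2 + r1) * v1) - (g11 * v2 - g12 * v1) * D2 / (2 * d))
    = g22 * u11 - g12 * (u12 + u21) + g11 * u22
      + (g12 * n2 - g22 * n1) * v1 + (g12 * n1 - g11 * n2) * v2"
    if "d \<noteq> 0" "d = g11 * g22 - g12\<^sup>2" "D1 = g11 * (2 * q2) + 2 * p1 * g22 - 2 * g12 * (p2 + q1)"
      "D2 = g11 * (2 * r2) + 2 * q1 * g22 - 2 * g12 * (q2 + r1)"
      "n1 = (g22 * p1 - 2 * g12 * q1 + g11 * r1) / d" "n2 = (g22 * p2 - 2 * g12 * q2 + g11 * r2) / d"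
    for g11 g12 g22 d D1 D2 n1 n2 p1 p2 q1 q2 r1 r2 v1 v2 u11 u12 u21 u22 :: real
  proof -
    have nd: "n1 * d = g22 * p1 - 2 * g12 * q1 + g11 * r1" "n2 * d = g22 * p2 - 2 * g12 * q2 + g11 * r2"
      using that by auto
    have "2 * (g12 * (n2 * d) - g22 * (n1 * d)) = 2 * d * (q2 - r1) - (g22 * D1 - g12 * D2)"
      unfolding nd unfolding that(2-4) by (simp add: power2_eq_square algebra_simps)
    then have e1: "g12 * n2 - g22 * n1 = (q2 - r1) - (g22 * D1 - g12 * D2) / (2 * d)"
      using that(1) by (simp add: field_simps)
    have "2 * (g12 * (n1 * d) - g11 * (n2 * d)) = 2 * d * (q1 - p2) - (g11 * D2 - g12 * D1)"
      unfolding nd unfolding that(2-4) by (simp add: power2_eq_square algebra_simps)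
    then have e2: "g12 * n1 - g11 * n2 = (q1 - p2) - (g11 * D2 - g12 * D1) / (2 * d)"
      using that(1) by (simp add: field_simps)
    show ?thesis unfolding e1 e2 by (simp add: algebra_simps add_divide_distrib diff_divide_distrib)
  qed
  have n: "N y \<bullet> X i y = (g22 y * (Y 1 1 y \<bullet> X i y) - 2 * g12 y * (Y 1 2 y \<bullet> X i y) + g11 y * (Y 2 2 y \<bullet> X i y)) / D y" for i
    by (simp add: N_def inner_add_left inner_diff_left add_divide_distrib diff_divide_distrib)
  have AB: "?A + ?B = g22 y * u2 1 1 y - g12 y * (u2 1 2 y + u2 2 1 y) + g11 y * u2 2 2 y
      + (g12 y * (N y \<bullet> X 2 y) - g22 y * (N y \<bullet> X 1 y)) * u1 1 y + (g12 y * (N y \<bullet> X 1 y) - g11 y * (N y \<bullet> X 2 y)) * u1 2 y"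
    unfolding P1_def P2_def
  proof (rule alg[OF _ D_def _ _ n n])
    show "D y \<noteq> 0" using D_pos[OF y] by simp
  qed (simp_all add: D'_def)
  show ?thesis unfolding LB AB lap_def b1_def b2_def
    by (simp add: add_divide_distrib)
qed

end

section \<open>Jets of the squared distance and of composite functions\<close>

lemma two_jet_inner_self:
  assumes F: "two_jet S F X Y"
  shows "two_jet S (\<lambda>y. (F y - p) \<bullet> (F y - p)) (\<lambda>i y. 2 * ((F y - p) \<bullet> X i y))
    (\<lambda>i j y. 2 * (X i y \<bullet> X j y + (F y - p) \<bullet> Y i j y))"
  unfolding two_jet_def
proof (intro ballI conjI allI)
  fix x i assume x: "x \<in> S"
  note d = has_derivative_diff[OF two_jetD(1)[OF F x] has_derivative_const[of p]]
  show "((\<lambda>y. (F y - p) \<bullet> (F y - p)) has_derivative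
     (\<lambda>h. h $ 1 *\<^sub>R (2 * ((F x - p) \<bullet> X 1 x)) + h $ 2 *\<^sub>R (2 * ((F x - p) \<bullet> X 2 x)))) (at x)"
    by (rule has_derivative_eq_rhs[OF has_derivative_inner[OF d d]])
       (auto simp: fun_eq_iff inner_add_right inner_commute[of _ "F x - p"])
  show "((\<lambda>y. 2 * ((F y - p) \<bullet> X i y)) has_derivative
     (\<lambda>h. h $ 1 *\<^sub>R (2 * (X i x \<bullet> X 1 x + (F x - p) \<bullet> Y i 1 x)) +
       h $ 2 *\<^sub>R (2 * (X i x \<bullet> X 2 x + (F x - p) \<bullet> Y i 2 x)))) (at x)"
    by (rule has_derivative_eq_rhs[OF has_derivative_mult_right[OF has_derivative_inner[OF d two_jetD(2)[OF F x]]]])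
       (auto simp: fun_eq_iff inner_add_right inner_commute[of _ "X i x"] distrib_left)
qed

lemma two_jet_compose:
  fixes q :: "real^2 \<Rightarrow> real"
  assumes q: "two_jet S q q1 q2"
    and \<phi>: "\<And>y. y \<in> S \<Longrightarrow> (\<phi> has_real_derivative \<phi>1 (q y)) (at (q y))"
    and \<phi>1: "\<And>y. y \<in> S \<Longrightarrow> (\<phi>1 has_real_derivative \<phi>2 (q y)) (at (q y))"
  shows "two_jet S (\<lambda>y. \<phi> (q y)) (\<lambda>i y. \<phi>1 (q y) * q1 i y)
    (\<lambda>i j y. \<phi>1 (q y) * q2 i j y + \<phi>2 (q y) * q1 i y * q1 j y)"
  unfolding two_jet_def
proof (intro ballI conjI allI)
  fix x i assume x: "x \<in> S"
  show "((\<lambda>y. \<phi> (q y)) has_derivative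
     (\<lambda>h. h $ 1 *\<^sub>R (\<phi>1 (q x) * q1 1 x) + h $ 2 *\<^sub>R (\<phi>1 (q x) * q1 2 x))) (at x)"
    by (rule has_derivative_eq_rhs[OF has_derivative_compose[OF two_jetD(1)[OF q x]
          \<phi>[OF x, unfolded has_field_derivative_def]]])
       (auto simp: fun_eq_iff algebra_simps)
  show "((\<lambda>y. \<phi>1 (q y) * q1 i y) has_derivative
     (\<lambda>h. h $ 1 *\<^sub>R (\<phi>1 (q x) * q2 i 1 x + \<phi>2 (q x) * q1 i x * q1 1 x) +
          h $ 2 *\<^sub>R (\<phi>1 (q x) * q2 i 2 x + \<phi>2 (q x) * q1 i x * q1 2 x))) (at x)"
    by (rule has_derivative_eq_rhs[OF has_derivative_mult[OF has_derivative_compose[OF two_jetD(1)[OF q x]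
          \<phi>1[OF x, unfolded has_field_derivative_def]] two_jetD(2)[OF q x]]])
       (auto simp: fun_eq_iff algebra_simps)
qed

lemma two_jet_diff_scaled:
  fixes u v :: "real^2 \<Rightarrow> real"
  assumes "two_jet S u u1 u2" "two_jet S v v1 v2"
  shows "two_jet S (\<lambda>y. u y - c * v y) (\<lambda>i y. u1 i y - c * v1 i y) (\<lambda>i j y. u2 i j y - c * v2 i j y)"
  unfolding two_jet_def
proof (intro ballI conjI allI)
  fix x i assume x: "x \<in> S"
  show "((\<lambda>y. u y - c * v y) has_derivative
     (\<lambda>h. h $ 1 *\<^sub>R (u1 1 x - c * v1 1 x) + h $ 2 *\<^sub>R (u1 2 x - c * v1 2 x))) (at x)"
    by (rule has_derivative_eq_rhs[OF has_derivative_diff[OF two_jetD(1)[OF assms(1) x]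
          has_derivative_mult_right[OF two_jetD(1)[OF assms(2) x]]]])
       (auto simp: fun_eq_iff algebra_simps)
  show "((\<lambda>y. u1 i y - c * v1 i y) has_derivative
     (\<lambda>h. h $ 1 *\<^sub>R (u2 i 1 x - c * v2 i 1 x) + h $ 2 *\<^sub>R (u2 i 2 x - c * v2 i 2 x))) (at x)"
    by (rule has_derivative_eq_rhs[OF has_derivative_diff[OF two_jetD(2)[OF assms(1) x]
          has_derivative_mult_right[OF two_jetD(2)[OF assms(2) x]]]])
       (auto simp: fun_eq_iff algebra_simps)
qed

lemma ambient_gradient_dist:
  assumes "z \<noteq> p"
  shows "ambient_gradient (dist p) z = (1 / dist p z) *\<^sub>R (z - p)"
proof -
  have n: "dist p = (\<lambda>z. norm (z - p))" by (auto simp: dist_norm norm_minus_commute)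
  have "((\<lambda>z. norm (z - p)) has_derivative (\<lambda>h. h \<bullet> sgn (z - p))) (at z)"
    by (rule has_derivative_compose[OF _ has_derivative_norm, where f' = "\<lambda>h. h"])
       (use assms in \<open>auto intro!: derivative_eq_intros\<close>)
  then have G: "GDERIV (dist p) z :> (1 / dist p z) *\<^sub>R (z - p)"
    unfolding gderiv_def n by (simp add: sgn_div_norm inverse_eq_divide)
  have "D = D'" if "GDERIV h z :> D" "GDERIV h z :> D'" for h :: "real^3 \<Rightarrow> real" and D D'
    using has_derivative_unique[OF that[unfolded gderiv_def]] by (metis vector_eq_ldot)
  then show ?thesis unfolding ambient_gradient_def using G by blast
qed

section \<open>The maximum principle, mean curvature and gradients in a patch\<close>

context immersed_patch begin

lemma metric_cont: "continuous_on S g11" "continuous_on S g12" "continuous_on S g22"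
  by (rule has_derivative_continuous_on, rule has_derivative_at_withinI, erule metric_derivs)+

lemma X_cont: "continuous_on S (X i)"
  by (rule has_derivative_continuous_on, rule has_derivative_at_withinI, erule two_jetD(2)[OF jet])

lemma D_cont: "continuous_on S D"
  unfolding D_def[abs_def] by (intro continuous_intros metric_cont)

lemma b_cont: "continuous_on S b1" "continuous_on S b2"
proof -
  have "continuous_on S N" unfolding N_def[abs_def]
    by (intro continuous_intros metric_cont Y_cont D_cont) (use D_pos in force)+
  then show "continuous_on S b1" "continuous_on S b2" unfolding b1_def[abs_def] b2_def[abs_def]
    by (intro continuous_intros metric_cont X_cont D_cont; use D_pos in force)+
qed

text \<open>The two vector fields are the columns of a Cholesky factor of the inverse metric.\<close>

lemma lap_strong_maximum_principle:
  assumes U: "open U" "U \<subseteq> S" "y0 \<in> U" and max: "\<And>x. x \<in> U \<Longrightarrow> w x \<le> w y0"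
    and w: "two_jet U w w1 w2" and sub: "\<And>x. x \<in> U \<Longrightarrow> lap w1 w2 x \<ge> 0"
  shows "\<exists>e>0. ball y0 e \<subseteq> U \<and> (\<forall>x\<in>ball y0 e. w x = w y0)"
proof -
  \<comment> \<open>These are the coordinates of the Gram-Schmidt frame of \<open>X 1\<close>,
    \<open>X 2\<close>, so the sum of their outer products is the inverse metric.\<close>
  define V :: "2 \<Rightarrow> real^2 \<Rightarrow> real^2" where
    "V k y = (if k = 1 then (1 / sqrt (g11 y)) *\<^sub>R axis 1 1
      else (1 / sqrt (g11 y * D y)) *\<^sub>R ((- g12 y) *\<^sub>R axis 1 1 + g11 y *\<^sub>R axis 2 1))" for k y
  define b :: "real^2 \<Rightarrow> real^2" where "b y = b1 y *\<^sub>R axis 1 1 + b2 y *\<^sub>R axis 2 1" for y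
  define W :: "real^2 \<Rightarrow> real^2" where "W y = w1 1 y *\<^sub>R axis 1 1 + w1 2 y *\<^sub>R axis 2 1" for y
  define H :: "real^2 \<Rightarrow> real^2 \<Rightarrow> real^2" where
    "H y h = (h$1 * w2 1 1 y + h$2 * w2 1 2 y) *\<^sub>R axis 1 1 + (h$1 * w2 2 1 y + h$2 * w2 2 2 y) *\<^sub>R axis 2 1" for y h
  have inner2: "u \<bullet> v = u$1 * v$1 + u$2 * v$2" for u v :: "real^2"
    by (simp add: inner_vec_def sum_2)
  show ?thesis
  proof (rule strong_maximum_principle[where w = w and S = U and Dw = W and H = H and K = UNIV and V = V and b = b])
    fix x assume x: "x \<in> U"
    then have xS: "x \<in> S" using U by auto
    have g: "g11 x > 0" and d: "D x > 0" using g11_pos D_pos xS by auto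
    show "(w has_derivative (\<bullet>) (W x)) (at x)"
      by (rule has_derivative_eq_rhs[OF two_jetD(1)[OF w x]])
         (simp add: fun_eq_iff W_def inner2 mult.commute)
    show "(W has_derivative H x) (at x)"
      unfolding W_def[abs_def] H_def[abs_def]
      using has_derivative_add[OF has_derivative_scaleR_left[OF two_jetD(2)[OF w x, of 1]]
          has_derivative_scaleR_left[OF two_jetD(2)[OF w x, of 2]]] by simp
    show "\<exists>k\<in>UNIV. V k x \<bullet> v \<noteq> 0" if "v \<noteq> 0" for v
    proof (rule ccontr)
      assume "\<not> ?thesis"
      then have "V 1 x \<bullet> v = 0" "V 2 x \<bullet> v = 0" by auto
      then have "v$1 = 0" "v$2 = 0" using g d by (auto simp: V_def inner2)
      then show False using that by (simp add: vec_eq_iff forall_2)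
    qed
    have q: "a * (1 / sqrt (e * s)) * (1 / sqrt (e * s)) = a / (e * s)" if "e > 0" "s > 0" for a e s :: real
      using that by (simp add: field_simps)
    have "(\<Sum>k\<in>UNIV. H x (V k x) \<bullet> V k x) + b x \<bullet> W x = lap w1 w2 x"
    proof -
      have 1: "H x (V 1 x) \<bullet> V 1 x = w2 1 1 x / g11 x"
        using g by (simp add: H_def V_def inner2 field_simps)
      have scale: "H x (c *\<^sub>R v) \<bullet> (c *\<^sub>R v) = (c * c) * (H x v \<bullet> v)" for c v
        by (simp add: H_def inner2 algebra_simps)
      have "V 2 x = (1 / sqrt (g11 x * D x)) *\<^sub>R ((- g12 x) *\<^sub>R axis 1 1 + g11 x *\<^sub>R axis 2 1)"
        by (simp add: V_def)
      then have H2: "H x (V 2 x) \<bullet> V 2 x = (1 / sqrt (g11 x * D x) * (1 / sqrt (g11 x * D x))) *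
        (H x ((- g12 x) *\<^sub>R axis 1 1 + g11 x *\<^sub>R axis 2 1) \<bullet> ((- g12 x) *\<^sub>R axis 1 1 + g11 x *\<^sub>R axis 2 1))"
        by (simp only: scale)
      have sq: "1 / sqrt (g11 x * D x) * (1 / sqrt (g11 x * D x)) = 1 / (g11 x * D x)"
        using q[of "g11 x" "D x" 1] g d by simp
      have 2: "H x (V 2 x) \<bullet> V 2 x = ((g12 x)\<^sup>2 * w2 1 1 x - g11 x * g12 x * (w2 1 2 x + w2 2 1 x) + (g11 x)\<^sup>2 * w2 2 2 x)
          / (g11 x * D x)"
        unfolding H2 sq
        by (simp add: H_def inner2 algebra_simps power2_eq_square add_divide_distrib diff_divide_distrib)
      \<comment> \<open>Brought to the common denominator so that
        \<open>D + g12^2 = g11 * g22\<close> turns the two contributions to the coefficient of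
        \<open>w2 1 1\<close> into \<open>g22 / D\<close>.\<close>
      have "w2 1 1 x / g11 x = ((g11 x * g22 x - (g12 x)\<^sup>2) * w2 1 1 x) / (g11 x * D x)"
        using g d by (simp add: D_def[symmetric])
      then have "H x (V 1 x) \<bullet> V 1 x + H x (V 2 x) \<bullet> V 2 x =
        (g11 x * (g22 x * w2 1 1 x - g12 x * (w2 1 2 x + w2 2 1 x) + g11 x * w2 2 2 x)) / (g11 x * D x)"
        unfolding 1 2 by (simp add: add_divide_distrib[symmetric] power2_eq_square algebra_simps)
      then have "H x (V 1 x) \<bullet> V 1 x + H x (V 2 x) \<bullet> V 2 x =
        (g22 x * w2 1 1 x - g12 x * (w2 1 2 x + w2 2 1 x) + g11 x * w2 2 2 x) / D x"
        using g by simp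
      then show ?thesis by (simp add: sum_2 lap_def b_def W_def inner2)
    qed
    then show "0 \<le> (\<Sum>k\<in>UNIV. H x (V k x) \<bullet> V k x) + b x \<bullet> W x" using sub[OF x] by simp
  next
    fix k :: 2
    note c = continuous_on_subset[OF _ U(2)]
    show "continuous_on U (V k)"
    proof (cases "k = 1")
      case True
      have "g11 x \<noteq> 0" if "x \<in> U" for x
        using g11_pos[of x] U(2) that by auto
      then show ?thesis unfolding V_def[abs_def] using True
        by (auto intro!: continuous_intros metric_cont[THEN c])
    next
      case False
      have "g11 x * D x \<noteq> 0" if "x \<in> U" for x
        using g11_pos[of x] D_pos[of x] U(2) that by auto
      then show ?thesis unfolding V_def[abs_def] using False
        by (auto intro!: continuous_intros metric_cont[THEN c] D_cont[THEN c])
    qed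
    show "continuous_on U b" unfolding b_def[abs_def]
      by (intro continuous_intros b_cont[THEN c])
  qed (use U max in auto)
qed

lemma inner_tangential_part:
  assumes "y \<in> S"
  shows "v \<bullet> tangential_part F y w =
    ((g22 y * (w \<bullet> X 1 y) - g12 y * (w \<bullet> X 2 y)) * (v \<bullet> X 1 y) +
     (g11 y * (w \<bullet> X 2 y) - g12 y * (w \<bullet> X 1 y)) * (v \<bullet> X 2 y)) / D y"
  unfolding tangential_part_def
  by (simp add: sum_2 inverse_form_entries[OF assms] two_jet_partial[OF jet assms]
      inner_add_right inner_diff_right add_divide_distrib diff_divide_distrib left_diff_distrib)

text \<open>Projection is linear, so the trace of the second fundamental form is \<open>N\<close>
  minus its tangential part, and \<open>b1\<close>, \<open>b2\<close> are the coordinates of minus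
  that part. In other words, the Laplacian of the immersion is twice the mean curvature
  vector.\<close>

lemma inner_mean_curvature_vector:
  assumes y: "y \<in> S"
  shows "2 * (v \<bullet> mean_curvature_vector F y) = v \<bullet> N y + b1 y * (v \<bullet> X 1 y) + b2 y * (v \<bullet> X 2 y)"
proof -
  define t where "t w = v \<bullet> tangential_part F y w" for w
  have "partial (partial F j) i y = partial (X j) i y" for i j
    by (rule partial_cong_open[OF S y]) (rule two_jet_partial[OF jet])
  then have p: "partial (partial F j) i y = Y j i y" for i j
    using two_jet_partial(2)[OF jet y] by simp
  have tN: "t (N y) = - b1 y * (v \<bullet> X 1 y) - b2 y * (v \<bullet> X 2 y)"
    unfolding t_def inner_tangential_part[OF y] b1_def b2_def using D_pos[OF y]
    by (simp add: field_simps)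
  have t_add: "t (w + w') = t w + t w'" and t_scale: "t (c *\<^sub>R w) = c * t w" for c w w'
    unfolding t_def inner_tangential_part[OF y]
    by (auto simp: inner_add_left add_divide_distrib[symmetric] algebra_simps)
  have t_diff: "t (w - w') = t w - t w'" for w w'
    using t_add[of w "(-1) *\<^sub>R w'"] t_scale[of "-1" w'] by simp
  have "2 * (v \<bullet> mean_curvature_vector F y) = v \<bullet> N y - t (N y)"
    unfolding mean_curvature_vector_def second_form_def p N_def t_add t_diff t_scale
    unfolding sum_2 inverse_form_entries[OF y] Y_sym[OF y] inner_scaleR_right inner_add_right inner_diff_right
      t_def[symmetric]
    by (simp add: algebra_simps add_divide_distrib diff_divide_distrib)
  then show ?thesis using tN by simp
qed

text \<open>The constant 4 is \<open>2 * g^ij * g_ij\<close>, twice the dimension; the factor 4 of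
  the second term is the 2 from differentiating a square times the 2 from the halved trace in the
  mean curvature vector.\<close>

lemma lap_squared_distance:
  assumes y: "y \<in> S"
  shows "lap (\<lambda>i y. 2 * ((F y - p) \<bullet> X i y)) (\<lambda>i j y. 2 * (X i y \<bullet> X j y + (F y - p) \<bullet> Y i j y)) y
    = 4 + 4 * ((F y - p) \<bullet> mean_curvature_vector F y)"
proof -
  have D: "D y \<noteq> 0" using D_pos[OF y] by simp
  define v where "v = F y - p"
  have vN: "v \<bullet> N y = (g22 y * (v \<bullet> Y 1 1 y) - 2 * g12 y * (v \<bullet> Y 1 2 y) + g11 y * (v \<bullet> Y 2 2 y)) / D y"
    by (simp add: N_def inner_add_right inner_diff_right add_divide_distrib diff_divide_distrib)
  have "(g22 y * (2 * (g11 y + v \<bullet> Y 1 1 y)) - g12 y * (2 * (g12 y + v \<bullet> Y 1 2 y) + 2 * (g12 y + v \<bullet> Y 2 1 y))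
     + g11 y * (2 * (g22 y + v \<bullet> Y 2 2 y))) / D y = (4 * D y) / D y + 2 * (v \<bullet> N y)"
    unfolding vN Y_sym[OF y] D_def
    by (simp add: add_divide_distrib[symmetric] power2_eq_square algebra_simps)
  also have "\<dots> = 4 + 2 * (v \<bullet> N y)" using D by simp
  finally show ?thesis
    unfolding lap_def v_def[symmetric] using inner_mean_curvature_vector[OF y, of v]
    by (simp add: g11_def g12_def g22_def inner_commute[of "X 2 y" "X 1 y"])
qed

text \<open>This is \<open>g^ij * u_i * u_j\<close>, the quadratic form that multiplies the second
  derivative in the chain rule for \<open>lap\<close>. Scaling the gradient by \<open>D\<close>
  clears the denominators of the inverse metric.\<close>

lemma norm_surface_gradient:
  assumes y: "y \<in> S"
  shows "(norm (surface_gradient F u y))\<^sup>2 =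
    (g22 y * (partial u 1 y)\<^sup>2 - 2 * g12 y * partial u 1 y * partial u 2 y + g11 y * (partial u 2 y)\<^sup>2) / D y"
proof -
  have D: "D y \<noteq> 0" using D_pos[OF y] by simp
  define u1 u2 where "u1 = partial u 1 y" and "u2 = partial u 2 y"
  have "D y *\<^sub>R surface_gradient F u y = (g22 y * u1 - g12 y * u2) *\<^sub>R X 1 y + (g11 y * u2 - g12 y * u1) *\<^sub>R X 2 y"
    unfolding surface_gradient_def u1_def u2_def using D
    by (simp add: sum_2 inverse_form_entries[OF y] two_jet_partial[OF jet y] scaleR_add_right
       scaleR_diff_left algebra_simps)
  note grad = this
  have "(D y *\<^sub>R surface_gradient F u y) \<bullet> (D y *\<^sub>R surface_gradient F u y) =
     (g22 y * u1 - g12 y * u2)\<^sup>2 * g11 y + 2 * (g22 y * u1 - g12 y * u2) * (g11 y * u2 - g12 y * u1) * g12 y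
     + (g11 y * u2 - g12 y * u1)\<^sup>2 * g22 y"
    unfolding grad
    by (simp add: inner_add_left inner_add_right g11_def[symmetric] g12_def[symmetric] g22_def[symmetric]
       inner_commute[of "X 2 y" "X 1 y"] power2_eq_square algebra_simps)
  also have "\<dots> = D y * (g22 y * u1\<^sup>2 - 2 * g12 y * u1 * u2 + g11 y * u2\<^sup>2)"
    by (simp add: D_def power2_eq_square algebra_simps)
  finally have "D y * (D y * (norm (surface_gradient F u y))\<^sup>2) = D y * (g22 y * u1\<^sup>2 - 2 * g12 y * u1 * u2 + g11 y * u2\<^sup>2)"
    by (simp only: power2_norm_eq_inner inner_scaleR_left inner_scaleR_right)
  then have "D y * (norm (surface_gradient F u y))\<^sup>2 = g22 y * u1\<^sup>2 - 2 * g12 y * u1 * u2 + g11 y * u2\<^sup>2"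
    using D by (metis mult_left_cancel)
  then show ?thesis unfolding u1_def[symmetric] u2_def[symmetric] using D
    by (simp add: nonzero_eq_divide_eq mult.commute)
qed

end

lemma two_jet_continuous_on: "two_jet S w w1 w2 \<Longrightarrow> continuous_on S w"
  by (rule has_derivative_continuous_on, rule has_derivative_at_withinI, erule (1) two_jetD)

section \<open>Superharmonicity of the radial potential\<close>

context immersed_patch begin

lemma lap_diff_scaled:
  "lap (\<lambda>i y. u1 i y - c * v1 i y) (\<lambda>i j y. u2 i j y - c * v2 i j y) y = lap u1 u2 y - c * lap v1 v2 y"
  unfolding lap_def by (simp add: algebra_simps add_divide_distrib diff_divide_distrib)

text \<open>Purely algebraic, so \<open>\<phi>1\<close> and \<open>\<phi>2\<close> are arbitrary
  functions of the parameters; in use they are the first and second derivatives of a function of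
  \<open>q\<close>, evaluated along \<open>q\<close>.\<close>

lemma lap_compose:
  "lap (\<lambda>i y. \<phi>1 y * q1 i y) (\<lambda>i j y. \<phi>1 y * q2 i j y + \<phi>2 y * q1 i y * q1 j y) y =
   \<phi>1 y * lap q1 q2 y +
   \<phi>2 y * ((g22 y * (q1 1 y)\<^sup>2 - 2 * g12 y * q1 1 y * q1 2 y + g11 y * (q1 2 y)\<^sup>2) / D y)"
  unfolding lap_def by (simp add: algebra_simps add_divide_distrib diff_divide_distrib power2_eq_square)

lemma radial_superharmonic:
  assumes U: "U \<subseteq> S"
    and ne: "\<And>y. y \<in> U \<Longrightarrow> F y \<noteq> p"
    and conv: "\<And>y. y \<in> U \<Longrightarrow> - (ambient_gradient (dist p) (F y) \<bullet> mean_curvature_vector F y) \<ge> 0"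
    and tang: "\<And>y. y \<in> U \<Longrightarrow> norm (surface_gradient F (\<lambda>y. dist p (F y)) y) \<ge> g (dist p (F y))"
    and g: "\<And>t. t > 0 \<Longrightarrow> g t > 0"
    and P: "\<And>t. t > 0 \<Longrightarrow> (P has_real_derivative t * e t) (at t)"
    and e: "\<And>t. t > 0 \<Longrightarrow> (e has_real_derivative - e t * (2 / (t * (g t)\<^sup>2))) (at t)"
    and e_pos: "\<And>t. t > 0 \<Longrightarrow> e t > 0"
  obtains v1 v2 where "two_jet U (\<lambda>y. P (dist p (F y))) v1 v2" "\<And>y. y \<in> U \<Longrightarrow> lap v1 v2 y \<le> 0"
proof -
  define q where "q y = (F y - p) \<bullet> (F y - p)" for y
  define q1 where "q1 i y = 2 * ((F y - p) \<bullet> X i y)" for i y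
  define q2 where "q2 i j y = 2 * (X i y \<bullet> X j y + (F y - p) \<bullet> Y i j y)" for i j y
  \<comment> \<open>First and second derivatives of \<open>P (sqrt s)\<close> in \<open>s\<close>.
    The factor \<open>t\<close> in the derivative of \<open>P\<close> cancels the
    \<open>1 / (2 * sqrt s)\<close> of the chain rule, leaving \<open>e / 2\<close>.\<close>
  define \<phi>1 where "\<phi>1 s = e (sqrt s) / 2" for s
  define \<phi>2 where "\<phi>2 s = - e (sqrt s) / (2 * s * (g (sqrt s))\<^sup>2)" for s
  have r: "dist p (F y) = sqrt (q y)" for y
    by (simp add: q_def dist_norm norm_eq_sqrt_inner inner_diff_left inner_diff_right)
  have q_pos: "q y > 0" if "y \<in> U" for y
    using ne[OF that] by (simp add: q_def)
  have jet_q: "two_jet U q q1 q2"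
    using two_jet_subset[OF two_jet_inner_self[OF jet, of p] U]
    unfolding q_def[abs_def] q1_def[abs_def] q2_def[abs_def] .
  have jet_v: "two_jet U (\<lambda>y. P (sqrt (q y))) (\<lambda>i y. \<phi>1 (q y) * q1 i y)
    (\<lambda>i j y. \<phi>1 (q y) * q2 i j y + \<phi>2 (q y) * q1 i y * q1 j y)"
  proof (rule two_jet_compose[OF jet_q])
    fix y assume "y \<in> U"
    then have s: "q y > 0" "sqrt (q y) > 0" using q_pos by auto
    have rt: "(sqrt has_real_derivative inverse (sqrt (q y)) / 2) (at (q y))"
      using DERIV_real_sqrt[OF s(1)] .
    show "((\<lambda>s. P (sqrt s)) has_real_derivative \<phi>1 (q y)) (at (q y))"
      using DERIV_chain2[OF P[OF s(2)] rt] s(2) by (simp add: \<phi>1_def field_simps)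
    have "(\<phi>1 has_real_derivative (- e (sqrt (q y)) * (2 / (sqrt (q y) * (g (sqrt (q y)))\<^sup>2)) * (inverse (sqrt (q y)) / 2)) / 2) (at (q y))"
      unfolding \<phi>1_def[abs_def] by (rule DERIV_cdivide[OF DERIV_chain2[OF e[OF s(2)] rt]])
    also have "(- e (sqrt (q y)) * (2 / (sqrt (q y) * (g (sqrt (q y)))\<^sup>2)) * (inverse (sqrt (q y)) / 2)) / 2
      = - e (sqrt (q y)) / (2 * (sqrt (q y) * sqrt (q y)) * (g (sqrt (q y)))\<^sup>2)"
    proof -
      have "(- a * (2 / (s * b)) * (inverse s / 2)) / 2 = - a / (2 * (s * s) * b)" if "s > 0" "b > 0" for a b s :: real
        using that by (simp add: field_simps)
      from this[OF s(2), of "(g (sqrt (q y)))\<^sup>2"] show ?thesis using g[OF s(2)] by simp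
    qed
    also have "\<dots> = \<phi>2 (q y)" using s by (simp add: \<phi>2_def)
    finally show "(\<phi>1 has_real_derivative \<phi>2 (q y)) (at (q y))" .
  qed
  have "lap (\<lambda>i y. \<phi>1 (q y) * q1 i y) (\<lambda>i j y. \<phi>1 (q y) * q2 i j y + \<phi>2 (q y) * q1 i y * q1 j y) y \<le> 0"
    if y: "y \<in> U" for y
  proof -
    have yS: "y \<in> S" using U y by auto
    define s where "s = sqrt (q y)"
    have s: "s > 0" "s\<^sup>2 = q y" "s * s = q y" using q_pos[OF y] by (auto simp: s_def)
    define Q where "Q = (g22 y * (q1 1 y)\<^sup>2 - 2 * g12 y * q1 1 y * q1 2 y + g11 y * (q1 2 y)\<^sup>2) / D y"
    have "((\<lambda>y. sqrt (q y)) has_derivative (\<lambda>h. (inverse (sqrt (q y)) / 2) * (h$1 *\<^sub>R q1 1 y + h$2 *\<^sub>R q1 2 y))) (at y)"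
      by (rule has_derivative_compose[OF two_jetD(1)[OF jet_q y]
            DERIV_real_sqrt[OF q_pos[OF y], unfolded has_field_derivative_def]])
    note dr = partial_eqI[OF this]
    have pr: "partial (\<lambda>y. dist p (F y)) i y = q1 i y / (2 * s)" for i
      unfolding r using exhaust_2[of i] dr[of i] by (auto simp: s_def field_simps)
    have "(norm (surface_gradient F (\<lambda>y. dist p (F y)) y))\<^sup>2 = Q / (4 * q y)"
      unfolding norm_surface_gradient[OF yS] pr Q_def s(2)[symmetric] power_divide power_mult_distrib
      by (simp add: add_divide_distrib diff_divide_distrib power2_eq_square mult_ac)
    moreover have "(g s)\<^sup>2 \<le> (norm (surface_gradient F (\<lambda>y. dist p (F y)) y))\<^sup>2"
      using tang[OF y] g[OF s(1)] unfolding r s_def[symmetric] by (intro power_mono) auto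
    ultimately have "(g s)\<^sup>2 \<le> Q / (4 * q y)" by simp
    then have "4 * q y * (g s)\<^sup>2 \<le> Q" using q_pos[OF y] by (simp add: pos_le_divide_eq mult.commute)
    moreover have "\<phi>2 (q y) < 0"
      unfolding \<phi>2_def s_def[symmetric] using e_pos[OF s(1)] g[OF s(1)] q_pos[OF y] by simp
    \<comment> \<open>Since \<open>\<phi>2\<close> is negative, the lower bound on the gradient
      becomes an upper bound, with value \<open>- 2 * e s\<close>; the convexity term below
      contributes at most \<open>2 * e s\<close>.\<close>
    ultimately have "\<phi>2 (q y) * Q \<le> \<phi>2 (q y) * (4 * q y * (g s)\<^sup>2)" by (simp add: mult_left_mono_neg)
    also have "\<dots> = - 2 * e s"
      unfolding \<phi>2_def s_def[symmetric] using g[OF s(1)] q_pos[OF y] by (simp add: field_simps)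
    finally have 1: "\<phi>2 (q y) * Q \<le> - 2 * e s" .
    have "F y - p = dist p (F y) *\<^sub>R ambient_gradient (dist p) (F y)"
      using ne[OF y] by (simp add: ambient_gradient_dist)
    then have "(F y - p) \<bullet> mean_curvature_vector F y =
      dist p (F y) * (ambient_gradient (dist p) (F y) \<bullet> mean_curvature_vector F y)"
      by (metis inner_scaleR_left)
    also have "\<dots> \<le> 0" using conv[OF y] by (simp add: mult_nonneg_nonpos)
    finally have "lap q1 q2 y \<le> 4"
      using lap_squared_distance[OF yS, of p] unfolding q1_def[abs_def] q2_def[abs_def] by simp
    moreover have "\<phi>1 (q y) > 0" unfolding \<phi>1_def s_def[symmetric] using e_pos[OF s(1)] by simp
    ultimately have "\<phi>1 (q y) * lap q1 q2 y \<le> \<phi>1 (q y) * 4" by simp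
    also have "\<dots> = 2 * e s" by (simp add: \<phi>1_def s_def)
    finally show ?thesis unfolding lap_compose Q_def[symmetric] using 1 by simp
  qed
  then show thesis using that jet_v unfolding r by blast
qed

end

subsection \<open>The radial potential\<close>

text \<open>\<open>e\<close> is built from an antiderivative on the whole open half-line, so the
  differential equations hold with two-sided derivatives at every \<open>t > 0\<close>, also at
  \<open>\<rho>\<close>. Below \<open>\<rho>\<close> the integral over \<open>{\<rho>..t}\<close> is
  0 by convention, so the explicit formula is claimed only from \<open>\<rho>\<close> on.\<close>

lemma radial_potential:
  fixes g :: "real \<Rightarrow> real"
  assumes cont: "continuous_on {0<..} g" and pos: "\<And>t. t > 0 \<Longrightarrow> g t > 0" and \<rho>: "\<rho> > 0"
  obtains P e where "\<And>t. t > 0 \<Longrightarrow> (P has_real_derivative t * e t) (at t)"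
    "\<And>t. t > 0 \<Longrightarrow> (e has_real_derivative - e t * (2 / (t * (g t)\<^sup>2))) (at t)"
    "\<And>t. t > 0 \<Longrightarrow> e t > 0" "P \<rho> = 0"
    "\<And>t. t \<ge> \<rho> \<Longrightarrow> e t = exp (- integral {\<rho>..t} (\<lambda>t. 2 / (t * (g t)\<^sup>2)))"
proof -
  have isg: "isCont g t" if "t > 0" for t
    using cont that by (simp add: continuous_on_eq_continuous_at)
  have "isCont (\<lambda>t. 2 / (t * (g t)\<^sup>2)) t" if "t > 0" for t
    using that pos[OF that] by (intro continuous_intros isg) auto
  then obtain J where "\<forall>t. ereal 0 < ereal t \<longrightarrow> ereal t < \<infinity> \<longrightarrow> (J has_vector_derivative 2 / (t * (g t)\<^sup>2)) (at t)"
    using einterval_antiderivative[of "ereal 0" \<infinity> "\<lambda>t. 2 / (t * (g t)\<^sup>2)"] by auto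
  then have J: "(J has_real_derivative 2 / (t * (g t)\<^sup>2)) (at t)" if "t > 0" for t
    using that by (simp add: has_real_derivative_iff_has_vector_derivative)
  define e where "e t = exp (- (J t - J \<rho>))" for t
  have e: "(e has_real_derivative - e t * (2 / (t * (g t)\<^sup>2))) (at t)" if "t > 0" for t
    unfolding e_def by (auto intro!: derivative_eq_intros J that)
  have "isCont (\<lambda>t. t * e t) t" if "t > 0" for t
    using DERIV_isCont[OF e[OF that]] by (intro continuous_intros)
  then obtain P0 where "\<forall>t. ereal 0 < ereal t \<longrightarrow> ereal t < \<infinity> \<longrightarrow> (P0 has_vector_derivative t * e t) (at t)"
    using einterval_antiderivative[of "ereal 0" \<infinity> "\<lambda>t. t * e t"] by auto
  then have P0: "(P0 has_real_derivative t * e t) (at t)" if "t > 0" for t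
    using that by (simp add: has_real_derivative_iff_has_vector_derivative)
  show thesis
  proof (rule that[of "\<lambda>t. P0 t - P0 \<rho>" e])
    show "((\<lambda>t. P0 t - P0 \<rho>) has_real_derivative t * e t) (at t)" if "t > 0" for t
      using DERIV_diff[OF P0[OF that] DERIV_const] by simp
    show "e t = exp (- integral {\<rho>..t} (\<lambda>t. 2 / (t * (g t)\<^sup>2)))" if "t \<ge> \<rho>" for t
    proof -
      have "((\<lambda>t. 2 / (t * (g t)\<^sup>2)) has_integral (J t - J \<rho>)) {\<rho>..t}"
        by (rule fundamental_theorem_of_calculus[OF that])
           (use J \<rho> in \<open>auto simp flip: has_real_derivative_iff_has_vector_derivative intro: has_field_derivative_at_within\<close>)
      then show ?thesis by (simp add: e_def integral_unique)
    qed
  qed (use e in \<open>auto simp: e_def\<close>)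
qed

lemma radial_potential_mono:
  fixes P e :: "real \<Rightarrow> real"
  assumes P: "\<And>t. t > 0 \<Longrightarrow> (P has_real_derivative t * e t) (at t)"
    and e_pos: "\<And>t. t > 0 \<Longrightarrow> e t > 0" and s: "0 < s" "s \<le> t"
  shows "P s \<le> P t"
proof (rule DERIV_nonneg_imp_nondecreasing[OF s(2)])
  fix x assume "s \<le> x"
  then have x: "x > 0" using s by simp
  show "\<exists>y. (P has_real_derivative y) (at x) \<and> 0 \<le> y"
    using P[OF x] e_pos[OF x] x by (intro exI[of _ "x * e x"]) simp
qed

text \<open>A bounded \<open>P\<close> would increase to a limit \<open>T\<close>, and the
  fundamental theorem on the half-line would evaluate the integral as the finite number
  \<open>T - P \<rho>\<close>.\<close>

lemma radial_potential_unbounded: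
  fixes P e f :: "real \<Rightarrow> real"
  assumes P: "\<And>t. t > 0 \<Longrightarrow> (P has_real_derivative t * e t) (at t)" and e: "continuous_on {0<..} e"
    and e_pos: "\<And>t. t > 0 \<Longrightarrow> e t > 0" and \<rho>: "\<rho> > 0" and f: "\<And>t. t \<ge> \<rho> \<Longrightarrow> f t = t * e t"
    and inf: "\<not> (\<integral>\<^sup>+ r \<in> {\<rho>..}. ennreal (f r) \<partial>lborel) < \<infinity>"
  shows "\<exists>t\<ge>\<rho>. P t > B"
proof (rule ccontr)
  assume "\<not> ?thesis"
  then have B: "P t \<le> B" if "t \<ge> \<rho>" for t using that by force
  \<comment> \<open>Extending the integrand by its value at \<open>\<rho>\<close> makes it
    continuous, hence Borel measurable, on the whole line.\<close>
  define h where "h t = max \<rho> t * e (max \<rho> t)" for t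
  have "continuous_on UNIV h" unfolding h_def[abs_def]
    by (intro continuous_intros continuous_on_compose2[OF e]) (use \<rho> in auto)
  then have meas: "h \<in> borel_measurable borel" by (rule borel_measurable_continuous_onI)
  have mono: "P s \<le> P t" if "\<rho> \<le> s" "s \<le> t" for s t
    using radial_potential_mono[of P e s t, OF P e_pos] that \<rho> by simp
  define T where "T = (SUP t\<in>{\<rho>..}. P t)"
  have bdd: "bdd_above (P ` {\<rho>..})" using B by (auto intro!: bdd_aboveI2[of _ _ B])
  have "(P \<longlongrightarrow> T) at_top"
  proof (rule increasing_tendsto)
    show "\<forall>\<^sub>F t in at_top. P t \<le> T"
      using eventually_ge_at_top[of \<rho>] by eventually_elim (auto simp: T_def intro!: cSUP_upper bdd)
    fix x assume "x < T"
    then obtain s where "s \<ge> \<rho>" "x < P s"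
      unfolding T_def using less_cSUP_iff[OF _ bdd, of x] by auto
    show "\<forall>\<^sub>F t in at_top. x < P t"
      using eventually_ge_at_top[of s]
    proof eventually_elim
      case (elim t)
      then show ?case using mono[of s t] \<open>s \<ge> \<rho>\<close> \<open>x < P s\<close> by simp
    qed
  qed
  from nn_integral_FTC_atLeast[OF meas _ _ this, of \<rho>]
  have "(\<integral>\<^sup>+ r. ennreal (h r) * indicator {\<rho>..} r \<partial>lborel) = ennreal (T - P \<rho>)"
    using P e_pos \<rho> by (auto simp: h_def max_def less_imp_le)
  moreover have "(\<integral>\<^sup>+ r. ennreal (h r) * indicator {\<rho>..} r \<partial>lborel) = (\<integral>\<^sup>+ r \<in> {\<rho>..}. ennreal (f r) \<partial>lborel)"
    by (rule nn_integral_cong) (auto simp: h_def f max_def indicator_def)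
  ultimately show False using inf by simp
qed

subsection \<open>From charts to the surface\<close>

lemma
  assumes "surface_chart M c"
  shows chart_openin: "openin M (fst c)"
    and chart_inj: "inj_on (snd c) (fst c)"
    and chart_image_open: "\<And>V. openin M V \<Longrightarrow> V \<subseteq> fst c \<Longrightarrow> open (snd c ` V)"
    and chart_preimage_open: "\<And>B. open B \<Longrightarrow> openin M {x \<in> fst c. snd c x \<in> B}"
    and chart_continuous_map: "continuous_map (subtopology M (fst c)) (top_of_set (snd c ` fst c)) (snd c)"
proof -
  obtain U \<phi> where c: "c = (U, \<phi>)" by force
  have U: "openin M U" "open (\<phi> ` U)" and hom: "homeomorphic_map (subtopology M U) (top_of_set (\<phi> ` U)) \<phi>"
    using assms by (auto simp: surface_chart_def c)
  have tU: "topspace (subtopology M U) = U" using openin_subset[OF U(1)] by auto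
  show "openin M (fst c)" using U c by simp
  show "inj_on (snd c) (fst c)" using homeomorphic_imp_injective_map[OF hom] tU c by simp
  show cm: "continuous_map (subtopology M (fst c)) (top_of_set (snd c ` fst c)) (snd c)"
    using homeomorphic_imp_continuous_map[OF hom] c by simp
  show "open (snd c ` V)" if "openin M V" "V \<subseteq> fst c" for V
  proof -
    have "openin (subtopology M U) V" using that c openin_open_subtopology[OF U(1)] by auto
    then have "openin (top_of_set (\<phi> ` U)) (\<phi> ` V)"
      using homeomorphic_map_openness[OF hom] openin_subset by blast
    then show ?thesis using U(2) openin_open_eq c by auto
  qed
  show "openin M {x \<in> fst c. snd c x \<in> B}" if "open B" for B
  proof -
    have "openin (subtopology M U) {x \<in> topspace (subtopology M U). \<phi> x \<in> \<phi> ` U \<inter> B}"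
      using homeomorphic_imp_continuous_map[OF hom]
      by (rule openin_continuous_map_preimage) (use that in \<open>auto simp: openin_open\<close>)
    also have "{x \<in> topspace (subtopology M U). \<phi> x \<in> \<phi> ` U \<inter> B} = {x \<in> U. \<phi> x \<in> B}"
      unfolding tU by auto
    finally show ?thesis using openin_open_subtopology[OF U(1)] c by simp
  qed
qed

lemma local_rep_chart:
  assumes "inj_on (snd c) (fst c)" "x \<in> fst c"
  shows "local_rep u c (snd c x) = u x"
  using assms by (simp add: local_rep_def)

lemma continuous_map_from_charts:
  fixes u :: "'a \<Rightarrow> 'b::topological_space"
  assumes chart: "\<And>c. c \<in> A \<Longrightarrow> surface_chart M c" and cover: "(\<Union>c\<in>A. fst c) = topspace M"
    and u: "\<And>c. c \<in> A \<Longrightarrow> continuous_on (snd c ` fst c) (local_rep u c)"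
  shows "continuous_map M euclidean u"
proof (rule pasting_lemma[of A M fst euclidean "\<lambda>_. u"])
  fix c assume c: "c \<in> A"
  have "continuous_map (subtopology M (fst c)) euclidean (local_rep u c \<circ> snd c)"
    by (rule continuous_map_compose[OF chart_continuous_map[OF chart[OF c]]]) (use u[OF c] in simp)
  then show "continuous_map (subtopology M (fst c)) euclidean u"
    by (rule continuous_map_eq) (simp add: local_rep_chart[OF chart_inj[OF chart[OF c]]])
qed (use chart_openin[OF chart] cover in blast)+

lemma immersed_patch_chart:
  assumes chart: "surface_chart M c" and c: "c \<in> A" and imm: "smooth_immersion A f"
  shows "immersed_patch (snd c ` fst c) (local_rep f c) (partial (local_rep f c))
    (\<lambda>i j. partial (partial (local_rep f c) i) j)"
proof
  let ?F = "local_rep f c" and ?S = "snd c ` fst c"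
  have ck: "Ck_on 2 ?F ?S" and inj: "\<And>y. y \<in> ?S \<Longrightarrow> inj (frechet_derivative ?F (at y))"
    using imm c by (auto simp: smooth_immersion_def smooth_on_def)
  show "open ?S" using chart by (auto simp: surface_chart_def split: prod.splits)
  show "two_jet ?S ?F (partial ?F) (\<lambda>i j. partial (partial ?F i) j)"
    and "\<And>i j. continuous_on ?S (partial (partial ?F i) j)"
    using Ck_on_2_two_jet[OF ck] by auto
  fix y a b assume y: "y \<in> ?S" and 0: "a *\<^sub>R partial ?F 1 y + b *\<^sub>R partial ?F 2 y = 0"
  have "?F differentiable (at y)"
    using two_jetD(1)[OF Ck_on_2_two_jet(1)[OF ck] y] by (rule differentiableI)
  then interpret linear "frechet_derivative ?F (at y)"
    by (rule linear_frechet_derivative)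
  have "frechet_derivative ?F (at y) (a *\<^sub>R axis 1 1 + b *\<^sub>R axis 2 1) = frechet_derivative ?F (at y) 0"
    using 0 by (simp add: add scaleR zero partial_def)
  then have z: "a *\<^sub>R axis 1 1 + b *\<^sub>R axis 2 1 = (0 :: real^2)" using inj[OF y] by (metis injD)
  from arg_cong[OF this, of "\<lambda>v. v$1"] arg_cong[OF this, of "\<lambda>v. v$2"]
  show "a = 0 \<and> b = 0" by simp
qed

text \<open>The conclusion is an open set of \<open>M\<close> rather than a ball in a chart, so it
  feeds directly into the connectedness argument.\<close>

lemma surface_strong_maximum_principle:
  assumes chart: "surface_chart M c" and patch: "immersed_patch (snd c ` fst c) F X Y"
    and V: "openin M V" "V \<subseteq> fst c" "x0 \<in> V" and max: "\<And>x. x \<in> V \<Longrightarrow> w x \<le> w x0"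
    and w: "two_jet (snd c ` V) (local_rep w c) w1 w2"
    and sub: "\<And>y. y \<in> snd c ` V \<Longrightarrow> immersed_patch.lap X Y w1 w2 y \<ge> 0"
  shows "\<exists>W. openin M W \<and> x0 \<in> W \<and> (\<forall>x\<in>W. w x = w x0)"
proof -
  note rep = local_rep_chart[OF chart_inj[OF chart]]
  have "\<exists>e>0. ball (snd c x0) e \<subseteq> snd c ` V \<and> (\<forall>y\<in>ball (snd c x0) e. local_rep w c y = local_rep w c (snd c x0))"
  proof (rule immersed_patch.lap_strong_maximum_principle[OF patch chart_image_open[OF chart V(1,2)] _ _ _ w sub])
    fix y assume "y \<in> snd c ` V"
    then obtain x where x: "x \<in> V" "y = snd c x" by blast
    then have "x \<in> fst c" "x0 \<in> fst c" using V by auto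
    then show "local_rep w c y \<le> local_rep w c (snd c x0)" using max x by (simp add: rep)
  qed (use V in auto)
  then obtain e where e: "e > 0" "\<And>y. y \<in> ball (snd c x0) e \<Longrightarrow> local_rep w c y = local_rep w c (snd c x0)"
    by blast
  have x0: "x0 \<in> fst c" using V by auto
  show ?thesis
  proof (intro exI conjI ballI)
    show "openin M {x \<in> fst c. snd c x \<in> ball (snd c x0) e}"
      by (rule chart_preimage_open[OF chart open_ball])
    show "w x = w x0" if "x \<in> {x \<in> fst c. snd c x \<in> ball (snd c x0) e}" for x
      using e(2)[of "snd c x"] that x0 by (simp add: rep)
  qed (use x0 e in auto)
qed

text \<open>The level set of \<open>w x0\<close> is closed by continuity and open by
  \<open>loc\<close>. Local constancy is asked only at this one value because the maximum principle
  supplies it only at maximum points.\<close>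

lemma constant_if_locally_constant_at_value:
  fixes w :: "'a \<Rightarrow> real"
  assumes M: "connected_space M" and w: "continuous_map M euclideanreal w" and x0: "x0 \<in> topspace M"
    and loc: "\<And>z. z \<in> topspace M \<Longrightarrow> w z = w x0 \<Longrightarrow> \<exists>W. openin M W \<and> z \<in> W \<and> (\<forall>x\<in>W. w x = w z)"
    and x: "x \<in> topspace M"
  shows "w x = w x0"
proof -
  define Z where "Z = {z \<in> topspace M. w z \<in> {w x0}}"
  have "closedin M Z" unfolding Z_def by (rule closedin_continuous_map_preimage[OF w]) simp
  moreover have "openin M Z"
  proof (subst openin_subopen, intro ballI)
    fix z assume "z \<in> Z"
    then obtain W where "openin M W" "z \<in> W" "\<forall>x\<in>W. w x = w x0" using loc[of z] by (auto simp: Z_def)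
    then show "\<exists>T. openin M T \<and> z \<in> T \<and> T \<subseteq> Z"
      using openin_subset by (intro exI[of _ W]) (force simp: Z_def)
  qed
  moreover have "x0 \<in> Z" using x0 by (simp add: Z_def)
  ultimately have "Z = topspace M" using M unfolding connected_space_clopen_in by blast
  then show ?thesis using x by (auto simp: Z_def)
qed

lemma compactin_attains_sup:
  fixes w :: "'a \<Rightarrow> real"
  assumes "compactin M K" "K \<noteq> {}" "continuous_map M euclideanreal w"
  obtains x where "x \<in> K" "\<And>y. y \<in> K \<Longrightarrow> w y \<le> w x"
proof -
  have "compact (w ` K)" using image_compactin[OF assms(1,3)] by simp
  then show thesis using compact_attains_sup[of "w ` K"] assms(2) that by blast
qed

lemma parabolic_if_potential_unbounded:
  fixes M :: "'a topology" and A :: "'a chart set" and f :: "'a \<Rightarrow> real^3"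
  assumes surf: "smooth_surface M A" and conn: "connected_space M"
    and imm: "smooth_immersion A f" and proper: "proper_map M euclidean f" and \<rho>: "\<rho> > 0"
    and convex: "radially_mean_convex A f p" and tang: "radial_tangency A f p g"
    and P: "\<And>t. t > 0 \<Longrightarrow> (P has_real_derivative t * e t) (at t)"
    and e: "\<And>t. t > 0 \<Longrightarrow> (e has_real_derivative - e t * (2 / (t * (g t)\<^sup>2))) (at t)"
    and e_pos: "\<And>t. t > 0 \<Longrightarrow> e t > 0" and P\<rho>: "P \<rho> = 0" and P_unbounded: "\<And>B. \<exists>t\<ge>\<rho>. P t > B"
  shows "parabolic M A f"
  unfolding parabolic_def
proof (intro allI impI)
  fix u assume u: "subharmonic_on_surface A f u \<and> bdd_above (u ` topspace M)"
  have chart: "\<And>c. c \<in> A \<Longrightarrow> surface_chart M c" and cover: "(\<Union>c\<in>A. fst c) = topspace M"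
    using surf by (auto simp: smooth_surface_def)
  note patch = immersed_patch_chart[OF chart _ imm]
  define r where "r x = dist p (f x)" for x
  have u2: "Ck_on 2 (local_rep u c) (snd c ` fst c)" if "c \<in> A" for c
    using u that by (auto simp: subharmonic_on_surface_def Ck_on_surface_def)
  have cu: "continuous_map M euclideanreal u"
    by (rule continuous_map_from_charts[OF chart cover two_jet_continuous_on[OF Ck_on_2_two_jet(1)[OF u2]]])
  have cf: "continuous_map M euclidean f"
  proof (rule continuous_map_from_charts[OF chart cover])
    fix c assume "c \<in> A"
    then have "Ck_on 0 (local_rep f c) (snd c ` fst c)"
      using imm unfolding smooth_immersion_def smooth_on_def by blast
    then show "continuous_on (snd c ` fst c) (local_rep f c)" by simp
  qed
  have cr: "continuous_map M euclideanreal r"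
    using continuous_map_compose[OF cf, of euclideanreal "dist p"]
    by (simp add: r_def[abs_def] o_def continuous_on_dist)
  \<comment> \<open>Properness of the immersion enters here: closed balls about \<open>p\<close>
    have compact preimages.\<close>
  have compact_sub: "compactin M {x \<in> topspace M. r x \<le> s}" for s
    using compactin_proper_map_preimage[OF proper, of "cball p s"] by (simp add: r_def)
  have jet_u: "two_jet (snd c ` fst c) (local_rep u c) (partial (local_rep u c))
      (\<lambda>i j. partial (partial (local_rep u c) i) j)" if "c \<in> A" for c
    using Ck_on_2_two_jet(1)[OF u2[OF that]] .
  have sub_u: "immersed_patch.lap (partial (local_rep f c)) (\<lambda>i j. partial (partial (local_rep f c) i) j)
     (partial (local_rep u c)) (\<lambda>i j. partial (partial (local_rep u c) i) j) y \<ge> 0"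
    if "c \<in> A" "y \<in> snd c ` fst c" for c y
    using immersed_patch.laplace_beltrami_eq_lap[OF patch[OF that(1,1)] immersed_patch.S[OF patch[OF that(1,1)]] subset_refl that(2) jet_u[OF that(1)]]
      u that unfolding subharmonic_on_surface_def by metis
  have max_u: "\<exists>W. openin M W \<and> z \<in> W \<and> (\<forall>x\<in>W. u x = u z)"
    if z: "z \<in> topspace M" "\<And>x. x \<in> topspace M \<Longrightarrow> u x \<le> u z" for z
  proof -
    obtain c where c: "c \<in> A" "z \<in> fst c" using cover z by blast
    show ?thesis
      by (rule surface_strong_maximum_principle[OF chart[OF c(1)] patch[OF c(1,1)]
            chart_openin[OF chart[OF c(1)]] subset_refl c(2) _ jet_u[OF c(1)] sub_u[OF c(1)]])
         (use z(2) cover c in auto)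
  qed
  have max_w: "\<exists>W. openin M W \<and> z \<in> W \<and> (\<forall>x\<in>W. u x - \<epsilon> * P (r x) = u z - \<epsilon> * P (r z))"
    if V: "openin M V" "z \<in> V" "\<And>x. x \<in> V \<Longrightarrow> r x > 0"
      and max: "\<And>x. x \<in> V \<Longrightarrow> u x - \<epsilon> * P (r x) \<le> u z - \<epsilon> * P (r z)" and eps: "\<epsilon> > 0" for V z \<epsilon>
  proof -
    obtain c where c: "c \<in> A" "z \<in> fst c" using cover V openin_subset by blast
    interpret immersed_patch "snd c ` fst c" "local_rep f c" "partial (local_rep f c)"
      "\<lambda>i j. partial (partial (local_rep f c) i) j" by (rule patch[OF c(1,1)])
    define V' where "V' = V \<inter> fst c"
    have V': "openin M V'" "V' \<subseteq> fst c" "z \<in> V'"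
      using V c chart_openin[OF chart[OF c(1)]] by (auto simp: V'_def)
    have sub: "snd c ` V' \<subseteq> snd c ` fst c" using V' by blast
    note rep = local_rep_chart[OF chart_inj[OF chart[OF c(1)]]]
    have loc_r: "(\<lambda>y. dist p (local_rep f c y)) = local_rep r c"
      by (simp add: local_rep_def r_def fun_eq_iff)
    obtain v1 v2 where v: "two_jet (snd c ` V') (\<lambda>y. P (dist p (local_rep f c y))) v1 v2"
      "\<And>y. y \<in> snd c ` V' \<Longrightarrow> lap v1 v2 y \<le> 0"
    proof (rule radial_superharmonic[OF sub, of p g P e])
      fix y assume "y \<in> snd c ` V'"
      then obtain x where x: "x \<in> V" "x \<in> fst c" "y = snd c x" by (auto simp: V'_def)
      have fx: "local_rep f c y = f x" using x by (simp add: rep)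
      have pos: "dist p (f x) > 0" using V(3)[OF x(1)] by (simp add: r_def)
      then show "local_rep f c y \<noteq> p" using fx by auto
      show "0 \<le> - (ambient_gradient (dist p) (local_rep f c y) \<bullet> mean_curvature_vector (local_rep f c) y)"
        using convex c(1) x pos fx by (auto simp: radially_mean_convex_def radial_mean_convexity_def)
      show "g (dist p (local_rep f c y)) \<le> norm (surface_gradient (local_rep f c) (\<lambda>y. dist p (local_rep f c y)) y)"
        unfolding loc_r fx using tang c(1) x pos by (auto simp: radial_tangency_def r_def[abs_def])
    next
      show "g t > 0" if "t > 0" for t
        using tang that by (auto simp: radial_tangency_def smooth_positive_halfline_def)
    qed (use P e e_pos in auto)
    have "(\<lambda>y. local_rep u c y - \<epsilon> * P (dist p (local_rep f c y))) = local_rep (\<lambda>x. u x - \<epsilon> * P (r x)) c"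
      by (simp add: local_rep_def r_def fun_eq_iff)
    then have jet_w: "two_jet (snd c ` V') (local_rep (\<lambda>x. u x - \<epsilon> * P (r x)) c)
      (\<lambda>i y. partial (local_rep u c) i y - \<epsilon> * v1 i y)
      (\<lambda>i j y. partial (partial (local_rep u c) i) j y - \<epsilon> * v2 i j y)"
      using two_jet_diff_scaled[OF two_jet_subset[OF jet_u[OF c(1)] sub] v(1), of \<epsilon>] by simp
    show ?thesis
    proof (rule surface_strong_maximum_principle[OF chart[OF c(1)] patch[OF c(1,1)] V' _ jet_w])
      show "u x - \<epsilon> * P (r x) \<le> u z - \<epsilon> * P (r z)" if "x \<in> V'" for x
        using max that by (simp add: V'_def)
      fix y assume y: "y \<in> snd c ` V'"
      have "\<epsilon> * lap v1 v2 y \<le> 0" using v(2)[OF y] eps by (simp add: mult_nonneg_nonpos)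
      then show "0 \<le> lap (\<lambda>i y. partial (local_rep u c) i y - \<epsilon> * v1 i y)
          (\<lambda>i j y. partial (partial (local_rep u c) i) j y - \<epsilon> * v2 i j y) y"
        unfolding lap_diff_scaled using sub_u[OF c(1), of y] y sub by force
    qed
  qed
  have P_mono: "P s \<le> P t" if "0 < s" "s \<le> t" for s t
    using radial_potential_mono[of P e s t, OF P e_pos] that by simp
  show "u constant_on topspace M"
  proof (cases "topspace M = {}")
    case True then show ?thesis by (simp add: constant_on_def)
  next
    case False
    then obtain a where a: "a \<in> topspace M" by blast
    \<comment> \<open>Taking \<open>R\<close> at least \<open>r a\<close> makes \<open>K\<close>
      nonempty, and \<open>R > 0\<close> keeps the region outside \<open>K\<close> away from the
      zero set of \<open>r\<close>.\<close>
    define R where "R = max \<rho> (r a)"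
    have R: "R \<ge> \<rho>" "R > 0" using \<rho> by (auto simp: R_def)
    define K where "K = {x \<in> topspace M. r x \<le> R}"
    have aK: "a \<in> K" using a by (simp add: K_def R_def)
    obtain k where k: "k \<in> K" "\<And>x. x \<in> K \<Longrightarrow> u x \<le> u k"
      using compactin_attains_sup[OF compact_sub[of R, folded K_def] _ cu] aK by blast
    have u_le: "u x \<le> u k" if x: "x \<in> topspace M" for x
    proof (rule ccontr)
      assume gt: "\<not> u x \<le> u k"
      then have rx: "r x > R" using k x by (force simp: K_def)
      have Prx: "P (r x) \<ge> 0" using P_mono[of \<rho> "r x"] rx R \<rho> P\<rho> by simp
      \<comment> \<open>The \<open>+ 1\<close> makes \<open>d\<close> positive, so that
        \<open>\<epsilon>\<close> can be chosen with \<open>\<epsilon> * P (r x)\<close> at most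
        half of the excess \<open>u x - u k\<close>.\<close>
      define d where "d = P (r x) + 1"
      have d: "d > 0" using Prx by (simp add: d_def)
      define \<epsilon> where "\<epsilon> = (u x - u k) / (2 * d)"
      have eps: "\<epsilon> > 0" using gt d by (simp add: \<epsilon>_def)
      have "\<epsilon> * P (r x) < u x - u k"
      proof -
        have "\<epsilon> * P (r x) \<le> \<epsilon> * d" using eps by (simp add: d_def)
        also have "\<dots> = (u x - u k) / 2" using d by (simp add: \<epsilon>_def)
        finally show ?thesis using gt by simp
      qed
      \<comment> \<open>Freezing the potential below radius \<open>R\<close> gives a function
        continuous on all of \<open>M\<close>, even where \<open>r\<close> vanishes; outside
        \<open>K\<close> it is still \<open>u - \<epsilon> * P(r)\<close>.\<close>
      define w where "w y = u y - \<epsilon> * P (max R (r y))" for y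
      have wx: "w x > u k" using \<open>\<epsilon> * P (r x) < u x - u k\<close> rx by (simp add: w_def)
      have cP: "continuous_on UNIV (\<lambda>t. P (max R t))"
      proof -
        have "continuous_on {0<..} P"
          using P by (auto intro!: continuous_at_imp_continuous_on DERIV_isCont)
        then show ?thesis
          by (rule continuous_on_compose2) (use R in \<open>auto intro!: continuous_intros\<close>)
      qed
      have cw: "continuous_map M euclideanreal w"
        unfolding w_def[abs_def]
        by (intro continuous_map_diff cu continuous_map_real_mult_left)
           (use continuous_map_compose[OF cr, of euclideanreal "\<lambda>t. P (max R t)"] cP in \<open>simp add: o_def\<close>)
      obtain B where B: "\<And>y. y \<in> topspace M \<Longrightarrow> u y \<le> B"
        using u by (auto simp: bdd_above_def)
      \<comment> \<open>Beyond radius \<open>t\<close> the penalty exceeds \<open>B - u k\<close>,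
        so \<open>w\<close> drops below \<open>u k\<close> and its maximum over the compact set
        \<open>T\<close> is global.\<close>
      obtain t where t: "t \<ge> \<rho>" "P t > (B - u k) / \<epsilon>" using P_unbounded by blast
      define T where "T = {y \<in> topspace M. r y \<le> max t (r x)}"
      have "x \<in> T" using x by (simp add: T_def)
      then obtain z where z: "z \<in> T" "\<And>y. y \<in> T \<Longrightarrow> w y \<le> w z"
        using compactin_attains_sup[OF compact_sub[of "max t (r x)", folded T_def] _ cw] by blast
      have wz: "w z > u k" using z(2)[OF \<open>x \<in> T\<close>] wx by simp
      have zM: "z \<in> topspace M" using z by (simp add: T_def)
      have far: "w y < u k" if "y \<in> topspace M" "y \<notin> T" for y
      proof -
        have ry: "r y > t" "r y > r x" using that by (auto simp: T_def)
        have "(B - u k) / \<epsilon> < P (r y)" using t P_mono[of t "r y"] \<rho> ry by simp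
        then have "B - u k < \<epsilon> * P (r y)" using eps by (simp add: field_simps)
        then show ?thesis using B[OF that(1)] ry rx by (simp add: w_def)
      qed
      have wmax: "w y \<le> w z" if "y \<in> topspace M" for y
        using that far[of y] z(2)[of y] wz by (cases "y \<in> T") auto
      have near: "w y \<le> u k" if "y \<in> K" for y
      proof -
        have "P R \<ge> 0" using P_mono[of \<rho> R] R \<rho> P\<rho> by simp
        then show ?thesis using k(2)[OF that] that eps by (simp add: w_def K_def max_def) (smt (verit) mult_nonneg_nonneg)
      qed
      \<comment> \<open>Points with value \<open>w z > u k\<close> lie outside \<open>K\<close> by
        \<open>near\<close>, where the maximum principle applies. Connectedness then carries this
        value to \<open>a\<close>, which lies in \<open>K\<close>: a contradiction.\<close>
      have "w a = w z"
      proof (rule constant_if_locally_constant_at_value[OF conn cw zM _ a])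
        fix y assume y: "y \<in> topspace M" "w y = w z"
        define V where "V = {x \<in> topspace M. r x \<in> {R<..}}"
        have V: "openin M V" unfolding V_def by (rule openin_continuous_map_preimage[OF cr]) simp
        have yV: "y \<in> V" using near[of y] y wz by (force simp: V_def K_def)
        have w_eq: "w x = u x - \<epsilon> * P (r x)" if "x \<in> V" for x using that by (simp add: w_def V_def max_def)
        obtain W where W: "openin M W" "y \<in> W" "\<forall>x\<in>W. u x - \<epsilon> * P (r x) = u y - \<epsilon> * P (r y)"
          using max_w[OF V yV _ _ eps] wmax y w_eq R yV by (force simp: V_def)
        have "openin M (W \<inter> V)" "y \<in> W \<inter> V" using W V yV by auto
        moreover have "w x = w y" if "x \<in> W \<inter> V" for x
          using w_eq[of x] w_eq[OF yV] bspec[OF W(3), of x] that by (metis IntE)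
        ultimately show "\<exists>W. openin M W \<and> y \<in> W \<and> (\<forall>x\<in>W. w x = w y)" by blast
      qed
      then show False using near[OF aK] wz by simp
    qed
    have kM: "k \<in> topspace M" using k by (simp add: K_def)
    have "u x = u k" if "x \<in> topspace M" for x
      by (rule constant_if_locally_constant_at_value[OF conn cu kM _ that])
         (use max_u u_le in metis)
    then show ?thesis unfolding constant_on_def by blast
  qed
qed

theorem corollary1p3:
  fixes M :: "'a topology" and A :: "'a chart set" and f :: "'a \<Rightarrow> real^3"
    and p :: "real^3" and \<rho> :: real
  assumes "smooth_surface M A"
    and "connected_space M"
    and "\<not> compact_space M"
    and "smooth_immersion A f"
    and "proper_map M euclidean f"
    and "\<rho> > 0"
    and "radially_mean_convex A f p"
    and "hyperbolic M A f"
  shows "\<not> (\<exists>g. radial_tangency A f p g) \<or>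
    (\<forall>g. radial_tangency A f p g \<longrightarrow>
      (\<integral>\<^sup>+ r \<in> {\<rho>..}. ennreal (r * exp (- integral {\<rho>..r} (\<lambda>t. 2 / (t * (g t)\<^sup>2)))) \<partial>lborel) < \<infinity>)"
proof (intro disjI2 allI impI, rule ccontr)
  fix g assume tang: "radial_tangency A f p g"
  assume inf: "\<not> (\<integral>\<^sup>+ r \<in> {\<rho>..}. ennreal (r * exp (- integral {\<rho>..r} (\<lambda>t. 2 / (t * (g t)\<^sup>2)))) \<partial>lborel) < \<infinity>"
  have g_pos: "g t > 0" if "t > 0" for t
    using tang that by (auto simp: radial_tangency_def smooth_positive_halfline_def)
  obtain h where h: "smooth_on h (UNIV :: real set)" "\<And>t. t \<ge> 0 \<Longrightarrow> g t = h t"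
    using tang by (auto simp: radial_tangency_def smooth_positive_halfline_def)
  \<comment> \<open>Continuity of \<open>g\<close> on the open half-line is inherited from the
    extension \<open>h\<close>, with which \<open>g\<close> is known to agree only for
    \<open>t \<ge> 0\<close>.\<close>
  have "Ck_on 0 h UNIV" using h(1) unfolding smooth_on_def by blast
  then have "continuous_on {0<..} h" using continuous_on_subset by force
  then have cg: "continuous_on {0<..} g" by (rule continuous_on_eq) (simp add: h(2))
  show False
  proof (rule radial_potential[OF cg g_pos \<open>\<rho> > 0\<close>])
    fix P e
    assume P: "\<And>t. t > 0 \<Longrightarrow> (P has_real_derivative t * e t) (at t)"
      and e: "\<And>t. t > 0 \<Longrightarrow> (e has_real_derivative - e t * (2 / (t * (g t)\<^sup>2))) (at t)"
      and e_pos: "\<And>t. t > 0 \<Longrightarrow> e t > 0" and P0: "P \<rho> = 0"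
      and e_eq: "\<And>t. t \<ge> \<rho> \<Longrightarrow> e t = exp (- integral {\<rho>..t} (\<lambda>t. 2 / (t * (g t)\<^sup>2)))"
    have ce: "continuous_on {0<..} e"
      using e by (auto intro!: continuous_at_imp_continuous_on DERIV_isCont)
    have unbounded: "\<exists>t\<ge>\<rho>. P t > B" for B
      by (rule radial_potential_unbounded[OF P ce e_pos \<open>\<rho> > 0\<close> _ inf]) (simp_all add: e_eq)
    have "parabolic M A f"
      by (rule parabolic_if_potential_unbounded[OF assms(1,2,4,5,6,7) tang P e e_pos P0 unbounded])
    then show False using assms(8) by (simp add: hyperbolic_def)
  qed
qed

end
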